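(* Let $\phi_{n,\alpha}(t)$ be the characteristic function of the random variable $$\frac{\log P_n(\alpha(\sigma))-\frac12\log^2n}{(1/\sqrt3)\log^{3/2}n}$$ on $S_n$ with the uniform probability measure. There exist fixed positive constants $u$ and $\delta_1$ such that $$\phi_{n,\alpha}(t)\ll e^{-t^2/4}\quad\text{for }|t|\leqslant\delta_1\log^{1/2}n,$$ $$\phi_{n,\alpha}(t)\ll\frac1{n^u}\quad\text{for }\delta_1\log^{1/2}n<|t|\leqslant\log^{3/2}n.$$
   Context: $\alpha_j(\sigma)$ is the number of cycles of length $j$ of $\sigma\in S_n$, $\alpha(\sigma)=(\alpha_1(\sigma),\dots,\alpha_n(\sigma))$, and $P_n(a)=\prod_{i=1}^n i^{a_i}$, so $\log P_n(\alpha(\sigma))=\sum_{j=1}^n\alpha_j(\sigma)\log j$. *)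

theory Defs
  imports "HOL-Probability.Probability" "HOL-Combinatorics.Orbits"
begin

definition cycles_on :: "nat \<Rightarrow> (nat \<Rightarrow> nat) \<Rightarrow> nat set set" where
  "cycles_on n \<sigma> = orbit \<sigma> ` {1..n}"

definition cycle_count :: "nat \<Rightarrow> (nat \<Rightarrow> nat) \<Rightarrow> nat \<Rightarrow> nat" where
  "cycle_count n \<sigma> j = card {c \<in> cycles_on n \<sigma>. card c = j}"

definition cycle_length_product :: "nat \<Rightarrow> (nat \<Rightarrow> nat) \<Rightarrow> nat" where
  "cycle_length_product n a = (\<Prod>i = 1..n. i ^ a i)"

definition uniform_perm :: "nat \<Rightarrow> (nat \<Rightarrow> nat) measure" where
  "uniform_perm n = measure_pmf (pmf_of_set {\<sigma>. \<sigma> permutes {1..n}})"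

text \<open>The centred and scaled variable is meaningful only for \<open>n \<ge> 2\<close>: at \<open>n = 1\<close> the
  denominator vanishes.\<close>

definition normalized_log_product :: "nat \<Rightarrow> (nat \<Rightarrow> nat) \<Rightarrow> real" where
  "normalized_log_product n \<sigma> =
     (ln (real (cycle_length_product n (cycle_count n \<sigma>))) - 1 / 2 * (ln (real n))\<^sup>2)
       / (1 / sqrt 3 * ln (real n) powr (3 / 2))"

definition log_product_char :: "nat \<Rightarrow> real \<Rightarrow> complex" where
  "log_product_char n = char (distr (uniform_perm n) borel (normalized_log_product n))"

end

theory Submission
  imports Defs "HOL-Complex_Analysis.Complex_Analysis"
begin

text \<open>
  Put \<open>\<tau> = \<surd>3 t / (ln n) powr (3/2)\<close> and \<open>f j = exp (\<i> \<tau> ln j)\<close>. Up to a factor of modulus 1 the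
  characteristic function is the mean \<open>M n\<close> over \<open>S\<^sub>n\<close> of the product of \<open>f\<close> over the cycle lengths.
  Splitting off the cycle of one point gives \<open>n M n = (\<Sum>k = 1..n. f k M (n - k))\<close>.

  If \<open>|\<tau>| ln n\<close> is small, subtracting consecutive recurrences and using \<open>|f (k + 1) - f k| \<le> |\<tau>| / k\<close>
  yields \<open>M (m + 1) / M m = 1 + (f (m + 1) - 1 + O(\<tau>)) / (m + 1)\<close>, hence
  \<open>|M n| \<lless> exp (- (\<Sum>j = 1..n. (1 - cos (\<tau> ln j)) / j))\<close>, and the last sum is at least
  \<open>2 t\<^sup>2 / 5 - O(1)\<close>.

  Otherwise \<open>n M n\<close> is the coefficient of \<open>z ^ (n - 1)\<close> in \<open>g' exp g\<close> with
  \<open>g z = (\<Sum>j = 1..n. f j z ^ j / j)\<close>. On the unit circle \<open>|g' z|\<close> is \<open>O(ln n / |1 - z|)\<close> and, by partial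
  summation, \<open>Re (g z)\<close> is at most \<open>(\<Sum>j = 1..N. cos (\<tau> ln j) / j) + O(1)\<close> for some \<open>N \<le> n\<close>; this sum is
  \<open>sin (\<tau> ln N) / \<tau> + O(1) \<le> (1 - u) ln n + O(1)\<close>, so Cauchy's formula saves a power of \<open>n\<close>.
\<close>

section \<open>Means of multiplicative functions over permutations\<close>

text \<open>The means \<open>M n\<close> of the overview, introduced through their recurrence;
  \<open>sum_cycle_weight\<close> identifies them with averages over permutations.\<close>

fun cycle_mean :: "(nat \<Rightarrow> complex) \<Rightarrow> nat \<Rightarrow> complex" where
  "cycle_mean f 0 = 1"
| "cycle_mean f (Suc n) = (\<Sum>k\<le>n. f (Suc k) * cycle_mean f (n - k)) / of_nat (Suc n)"

lemma cycle_mean_recurrence: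
  "of_nat n * cycle_mean f n = (\<Sum>k<n. f (Suc k) * cycle_mean f (n - Suc k))"
  by (cases n) (simp_all add: lessThan_Suc_atMost del: of_nat_Suc)

text \<open>Shifting the index in the recurrence for \<open>Suc n\<close> aligns its terms with
  those for \<open>n\<close>. The leftover \<open>f 1 * M n\<close> equals \<open>M n\<close> and,
  added to \<open>n * M n\<close>, accounts for the factor \<open>Suc n\<close> on
  \<open>M n\<close>.\<close>

lemma cycle_mean_difference:
  assumes "f 1 = 1"
  shows "of_nat (Suc n) * (cycle_mean f (Suc n) - cycle_mean f n)
           = (\<Sum>k<n. (f (Suc (Suc k)) - f (Suc k)) * cycle_mean f (n - Suc k))"
proof -
  have "of_nat (Suc n) * cycle_mean f (Suc n)
      = f 1 * cycle_mean f n + (\<Sum>k<n. f (Suc (Suc k)) * cycle_mean f (n - Suc k))"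
    by (subst cycle_mean_recurrence) (simp only: sum.lessThan_Suc_shift, simp)
  moreover note cycle_mean_recurrence[of n f]
  ultimately show ?thesis using assms
    by (simp add: algebra_simps sum_subtractf)
qed

text \<open>For \<open>j > 0\<close> this is j to the power i\<tau>, a completely multiplicative
  function of modulus 1.\<close>

definition power_twist :: "real \<Rightarrow> nat \<Rightarrow> complex" where
  "power_twist \<tau> j = cis (\<tau> * ln (real j))"

lemma power_twist_1 [simp]: "power_twist \<tau> 1 = 1" "power_twist \<tau> (Suc 0) = 1"
  by (simp_all add: power_twist_def)

lemma norm_power_twist [simp]: "norm (power_twist \<tau> j) = 1"
  by (simp add: power_twist_def)

section \<open>Splitting a permutation at the cycle of one point\<close>

definition cycle_weight :: "(nat \<Rightarrow> complex) \<Rightarrow> 'a set \<Rightarrow> ('a \<Rightarrow> 'a) \<Rightarrow> complex" where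
  "cycle_weight f S \<sigma> = (\<Prod>c\<in>orbit \<sigma> ` S. f (card c))"

text \<open>For \<open>a\<close> in a finite \<open>C\<close> these are the permutations of
  \<open>C\<close> that consist of one single cycle, \<open>a\<close> being a base point on
  it.\<close>

definition cyclic_perms :: "'a \<Rightarrow> 'a set \<Rightarrow> ('a \<Rightarrow> 'a) set" where
  "cyclic_perms a C = {p. p permutes C \<and> orbit p a = C}"

lemma permutes_self_in_orbit:
  assumes "finite S" "p permutes S"
  shows "x \<in> orbit p x"
  using assms by (intro permutation_self_in_orbit) (auto simp: permutation_permutes)

lemma orbit_comp_left:
  assumes "finite C" "p permutes C" "q permutes D" "C \<inter> D = {}" "x \<in> C"
  shows "orbit (p \<circ> q) x = orbit p x"
proof (rule orbit_cong)
  show "x \<in> orbit p x" by (rule permutes_self_in_orbit) fact+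
  fix s assume "s \<in> orbit p x"
  then have "s \<in> C" using permutes_orbit_subset[OF assms(2,5)] by blast
  then have "q s = s" using assms by (intro permutes_not_in[of q D]) auto
  then show "(p \<circ> q) s = p s" by simp
qed

lemma orbit_comp_right:
  assumes "finite D" "p permutes C" "q permutes D" "C \<inter> D = {}" "x \<in> D"
  shows "orbit (p \<circ> q) x = orbit q x"
proof (rule orbit_cong)
  show "x \<in> orbit q x" by (rule permutes_self_in_orbit) fact+
  fix s assume "s \<in> orbit q x"
  then have "q s \<in> D" using permutes_orbit_subset[of q D x] assms by (auto simp: permutes_in_image)
  then have "p (q s) = q s" using assms by (intro permutes_not_in[of p C]) auto
  then show "(p \<circ> q) s = q s" by simp
qed

lemma cycle_weight_comp:
  assumes "finite S" "C \<subseteq> S" "a \<in> C" "p \<in> cyclic_perms a C" "q permutes (S - C)"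
  shows "cycle_weight f S (p \<circ> q) = f (card C) * cycle_weight f (S - C) q"
proof -
  have p: "p permutes C" "orbit p a = C" using assms by (auto simp: cyclic_perms_def)
  have fin: "finite C" "finite (S - C)" using assms finite_subset by auto
  have "orbit p x = C" if "x \<in> C" for x
    using cyclic_on_orbit[OF p(1) fin(1), of a] that p by (metis orbit_cyclic_eq3)
  then have C: "orbit (p \<circ> q) x = C" if "x \<in> C" for x
    using orbit_comp_left[OF fin(1) p(1) assms(5) _ that] that by auto
  have D: "orbit (p \<circ> q) x = orbit q x" if "x \<in> S - C" for x
    using orbit_comp_right[OF fin(2) p(1) assms(5) _ that] by auto
  have "S = C \<union> (S - C)" using assms by auto
  then have "orbit (p \<circ> q) ` S = orbit (p \<circ> q) ` C \<union> orbit (p \<circ> q) ` (S - C)" by (metis image_Un)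
  also have "orbit (p \<circ> q) ` C = {C}" using C assms by auto
  also have "orbit (p \<circ> q) ` (S - C) = orbit q ` (S - C)" using D by (auto simp: image_def)
  finally have eq: "orbit (p \<circ> q) ` S = insert C (orbit q ` (S - C))"
    by (simp only: insert_is_Un[symmetric])
  \<comment> \<open>The weight is a product over a set of orbits, so the factor of \<open>C\<close>
    splits off only because \<open>C\<close> is a new element: every orbit of \<open>q\<close> here
    contains a point outside \<open>C\<close>.\<close>
  have "C \<notin> orbit q ` (S - C)"
    using permutes_self_in_orbit[OF fin(2) assms(5)] by auto
  then have "(\<Prod>c\<in>insert C (orbit q ` (S - C)). f (card c)) = f (card C) * (\<Prod>c\<in>orbit q ` (S - C). f (card c))"
    using fin by simp
  then show ?thesis unfolding cycle_weight_def eq .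
qed

lemma perm_restrict_orbit_permutes:
  assumes "finite S" "\<sigma> permutes S" "a \<in> S"
  shows "perm_restrict \<sigma> (orbit \<sigma> a) permutes orbit \<sigma> a"
proof (rule bij_imp_permutes)
  let ?C = "orbit \<sigma> a"
  have "finite ?C" using permutes_orbit_subset[OF assms(2,3)] assms(1) finite_subset by blast
  moreover have "\<sigma> ` ?C \<subseteq> ?C" by (auto intro: orbit.intros)
  moreover have "inj_on \<sigma> ?C" using permutes_inj[OF assms(2)] inj_on_subset by blast
  ultimately have "bij_betw \<sigma> ?C ?C" by (simp add: bij_betw_def endo_inj_surj)
  then show "bij_betw (perm_restrict \<sigma> ?C) ?C ?C"
    by (subst bij_betw_cong[of _ _ \<sigma>]) (auto simp: perm_restrict_simps)
qed (simp add: perm_restrict_simps)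

text \<open>A permutation whose cycle through \<open>a\<close> is \<open>C\<close> amounts to a
  pair: a cyclic permutation of \<open>C\<close> and an arbitrary permutation of the rest.
  Restriction and composition are inverse bijections, and the first component enters the weight only
  through \<open>card C\<close>.\<close>

lemma sum_cycle_weight_orbit:
  assumes "finite S" "C \<subseteq> S" "a \<in> C"
  shows "(\<Sum>\<sigma> | \<sigma> permutes S \<and> orbit \<sigma> a = C. cycle_weight f S \<sigma>)
     = of_nat (card (cyclic_perms a C)) * f (card C) * (\<Sum>q | q permutes (S - C). cycle_weight f (S - C) q)"
proof -
  have "(\<Sum>\<sigma> | \<sigma> permutes S \<and> orbit \<sigma> a = C. cycle_weight f S \<sigma>)
      = (\<Sum>(p, q) \<in> cyclic_perms a C \<times> {q. q permutes (S - C)}. f (card C) * cycle_weight f (S - C) q)"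
  proof (rule sum.reindex_bij_witness[where i = "\<lambda>(p, q). p \<circ> q"
        and j = "\<lambda>\<sigma>. (perm_restrict \<sigma> C, perm_restrict \<sigma> (S - C))"])
    fix \<sigma> assume \<sigma>: "\<sigma> \<in> {\<sigma>. \<sigma> permutes S \<and> orbit \<sigma> a = C}"
    then have cyc: "cyclic_on \<sigma> C" using cyclic_on_orbit[of \<sigma> S a] assms by auto
    have p: "perm_restrict \<sigma> C permutes C"
      using perm_restrict_orbit_permutes[of S \<sigma> a] \<sigma> assms by auto
    have q: "perm_restrict \<sigma> (S - C) permutes (S - C)"
      using \<sigma> cyc by (intro perm_restrict_diff_cyclic) auto
    have "orbit (perm_restrict \<sigma> C) a = orbit \<sigma> a"
      by (rule orbit_cong) (use \<sigma> assms in \<open>auto simp: perm_restrict_simps\<close>)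
    then have cp: "perm_restrict \<sigma> C \<in> cyclic_perms a C" using p \<sigma> by (auto simp: cyclic_perms_def)
    have "C \<union> (S - C) = S" using assms by auto
    then have comp: "perm_restrict \<sigma> C \<circ> perm_restrict \<sigma> (S - C) = \<sigma>"
      using perm_restrict_union[OF p q] \<sigma> by simp
    then show "(case (perm_restrict \<sigma> C, perm_restrict \<sigma> (S - C)) of (p, q) \<Rightarrow> p \<circ> q) = \<sigma>" by simp
    show "(perm_restrict \<sigma> C, perm_restrict \<sigma> (S - C)) \<in> cyclic_perms a C \<times> {q. q permutes (S - C)}"
      using cp q by simp
    show "(case (perm_restrict \<sigma> C, perm_restrict \<sigma> (S - C)) of (p, q) \<Rightarrow> f (card C) * cycle_weight f (S - C) q)
        = cycle_weight f S \<sigma>"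
      using cycle_weight_comp[OF assms cp q] comp by simp
  next
    fix pq assume "pq \<in> cyclic_perms a C \<times> {q. q permutes (S - C)}"
    then obtain p q where pq: "pq = (p, q)" "p permutes C" "orbit p a = C" "q permutes (S - C)"
      by (auto simp: cyclic_perms_def)
    have fin: "finite C" using assms finite_subset by auto
    have "p \<circ> q permutes S"
      using pq assms by (intro permutes_compose) (auto intro: permutes_subset)
    moreover have "orbit (p \<circ> q) a = C"
      using orbit_comp_left[OF fin pq(2,4)] assms pq by auto
    ultimately show "(case pq of (p, q) \<Rightarrow> p \<circ> q) \<in> {\<sigma>. \<sigma> permutes S \<and> orbit \<sigma> a = C}"
      by (simp add: pq)
    have "perm_restrict (p \<circ> q) C = p"
      using permutes_not_in[OF pq(4)] permutes_not_in[OF pq(2)]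
      by (auto simp: perm_restrict_def fun_eq_iff)
    moreover have "perm_restrict (p \<circ> q) (S - C) = q"
    proof
      fix x
      show "perm_restrict (p \<circ> q) (S - C) x = q x"
      proof (cases "x \<in> S - C")
        case True
        then have "q x \<in> S - C" using permutes_in_image[OF pq(4), of x] by blast
        then show ?thesis using True permutes_not_in[OF pq(2), of "q x"] by (simp add: perm_restrict_simps)
      next
        case False
        then show ?thesis using permutes_not_in[OF pq(4)] by (simp add: perm_restrict_simps)
      qed
    qed
    ultimately show "(perm_restrict (case pq of (p, q) \<Rightarrow> p \<circ> q) C,
        perm_restrict (case pq of (p, q) \<Rightarrow> p \<circ> q) (S - C)) = pq"
      by (simp add: pq)
  qed
  also have "\<dots> = of_nat (card (cyclic_perms a C)) * f (card C) * (\<Sum>q | q permutes (S - C). cycle_weight f (S - C) q)"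
    by (simp add: sum.cartesian_product[symmetric] sum_distrib_left mult_ac)
  finally show ?thesis .
qed

lemma sum_cycle_weight_decompose:
  assumes "finite S" "a \<in> S"
  shows "(\<Sum>\<sigma> | \<sigma> permutes S. cycle_weight f S \<sigma>)
     = (\<Sum>C | a \<in> C \<and> C \<subseteq> S. of_nat (card (cyclic_perms a C)) * f (card C)
          * (\<Sum>q | q permutes (S - C). cycle_weight f (S - C) q))"
proof -
  have "(\<lambda>\<sigma>. orbit \<sigma> a) ` {\<sigma>. \<sigma> permutes S} \<subseteq> {C. a \<in> C \<and> C \<subseteq> S}"
    using permutes_self_in_orbit[OF assms(1)] permutes_orbit_subset[OF _ assms(2)] by auto
  moreover have "finite {C. a \<in> C \<and> C \<subseteq> S}"
    by (rule finite_subset[of _ "Pow S"]) (use assms in auto)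
  ultimately have "(\<Sum>\<sigma> | \<sigma> permutes S. cycle_weight f S \<sigma>)
      = (\<Sum>C | a \<in> C \<and> C \<subseteq> S. \<Sum>\<sigma> | \<sigma> \<in> {\<sigma>. \<sigma> permutes S} \<and> orbit \<sigma> a = C. cycle_weight f S \<sigma>)"
    by (intro sum.group[symmetric] finite_permutations assms)
  also have "\<dots> = (\<Sum>C | a \<in> C \<and> C \<subseteq> S. of_nat (card (cyclic_perms a C)) * f (card C)
          * (\<Sum>q | q permutes (S - C). cycle_weight f (S - C) q))"
    using sum_cycle_weight_orbit[OF assms(1)] by (intro sum.cong) auto
  finally show ?thesis .
qed

section \<open>Counting by the size of the cycle\<close>

lemma sum_Pow_card:
  fixes g :: "nat \<Rightarrow> complex"
  assumes "finite D"
  shows "(\<Sum>X\<in>Pow D. g (card X)) = (\<Sum>k\<le>card D. of_nat (card D choose k) * g k)"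
proof -
  have "(\<Sum>X\<in>Pow D. g (card X)) = (\<Sum>k\<le>card D. \<Sum>X | X \<in> Pow D \<and> card X = k. g (card X))"
    by (rule sum.group[symmetric]) (use assms card_mono in auto)
  also have "\<dots> = (\<Sum>k\<le>card D. \<Sum>X | X \<subseteq> D \<and> card X = k. g k)"
    by (intro sum.cong) auto
  also have "\<dots> = (\<Sum>k\<le>card D. of_nat (card D choose k) * g k)"
    by (simp add: n_subsets[OF assms])
  finally show ?thesis .
qed

lemma sum_containing_card:
  fixes g :: "nat \<Rightarrow> complex"
  assumes "finite S" "a \<in> S" "card S = Suc n"
  shows "(\<Sum>C | a \<in> C \<and> C \<subseteq> S. g (card C)) = (\<Sum>k\<le>n. of_nat (n choose k) * g (Suc k))"
proof -
  have "(\<Sum>C | a \<in> C \<and> C \<subseteq> S. g (card C)) = (\<Sum>X\<in>Pow (S - {a}). g (Suc (card X)))"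
  proof (rule sum.reindex_bij_witness[where i = "insert a" and j = "\<lambda>C. C - {a}"])
    fix C assume "C \<in> {C. a \<in> C \<and> C \<subseteq> S}"
    then have "a \<in> C" "finite C" using assms finite_subset by auto
    then have "Suc (card (C - {a})) = card C" by (rule card_Suc_Diff1[rotated])
    then show "g (Suc (card (C - {a}))) = g (card C)" by simp
  qed (use assms in auto)
  also have "\<dots> = (\<Sum>k\<le>n. of_nat (n choose k) * g (Suc k))"
    using assms by (subst sum_Pow_card) auto
  finally show ?thesis .
qed

lemma binomial_fact_complex:
  assumes "k \<le> n"
  shows "of_nat (n choose k) * (fact k * fact (n - k)) = (fact n :: complex)"
  using binomial_fact_lemma[OF assms]
  by (metis mult.commute of_nat_fact of_nat_mult)

text \<open>The constant weight \<open>f = 1\<close> in the decomposition counts all permutations, which determines the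
  number of cyclic ones by induction.\<close>

lemma card_cyclic_perms:
  assumes "finite C" "a \<in> C"
  shows "of_nat (card (cyclic_perms a C)) = (fact (card C - 1) :: complex)"
  using assms
proof (induction C rule: finite_psubset_induct)
  case (psubset C)
  define n where "n = card C - 1"
  have n: "card C = Suc n" using psubset card_gt_0_iff[of C] by (auto simp: n_def)
  \<comment> \<open>\<open>g k\<close> is the expected contribution of a set of size
    \<open>k\<close>. Over all sets containing \<open>a\<close> these contributions add up to
    \<open>Suc n * fact n\<close>, which is the total count; with the proper subsets settled by
    induction, \<open>C\<close> itself must contribute \<open>g (card C)\<close>.\<close>
  define g :: "nat \<Rightarrow> complex" where "g k = fact (k - 1) * fact (card C - k)" for k
  let ?A = "{D. a \<in> D \<and> D \<subseteq> C}"
  have finA: "finite ?A" by (rule finite_subset[of _ "Pow C"]) (use psubset in auto)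
  have CA: "C \<in> ?A" using psubset by auto
  have one: "(\<Sum>q | q permutes X. cycle_weight (\<lambda>_. 1) X q) = fact (card X)" if "finite X" for X :: "'a set"
    using card_permutations[OF refl that] by (simp add: cycle_weight_def)
  have "fact (card C) = (\<Sum>D\<in>?A. of_nat (card (cyclic_perms a D)) * (fact (card (C - D)) :: complex))"
    using sum_cycle_weight_decompose[OF psubset.hyps psubset.prems, of "\<lambda>_. 1"] psubset.hyps
    by (simp add: one)
  also have "\<dots> = of_nat (card (cyclic_perms a C)) + (\<Sum>D\<in>?A - {C}. of_nat (card (cyclic_perms a D)) * fact (card (C - D)))"
    by (subst sum.remove[OF finA CA]) simp
  also have "(\<Sum>D\<in>?A - {C}. of_nat (card (cyclic_perms a D)) * (fact (card (C - D)) :: complex)) = (\<Sum>D\<in>?A - {C}. g (card D))"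
  proof (intro sum.cong refl)
    fix D assume D: "D \<in> ?A - {C}"
    then have "D \<subset> C" "a \<in> D" "finite D" using psubset.hyps finite_subset by auto
    then show "of_nat (card (cyclic_perms a D)) * (fact (card (C - D)) :: complex) = g (card D)"
      using psubset.IH[of D] psubset.hyps by (simp add: g_def card_Diff_subset psubset_imp_subset)
  qed
  also have "\<dots> = (\<Sum>D\<in>?A. g (card D)) - g (card C)"
    using finA CA by (simp add: sum_diff1)
  also have "(\<Sum>D\<in>?A. g (card D)) = (\<Sum>k\<le>n. of_nat (n choose k) * (fact k * fact (n - k)))"
    by (subst sum_containing_card[OF psubset.hyps psubset.prems n]) (simp add: g_def n)
  also have "\<dots> = (\<Sum>k\<le>n. fact n)"
    by (intro sum.cong refl binomial_fact_complex) auto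
  finally show ?case by (simp add: g_def n algebra_simps)
qed

text \<open>Induction along the split at one point: a cycle on \<open>C\<close> can be chosen in
  \<open>fact (card C - 1)\<close> ways, and the number of sets of each size cancels the factorials
  down to \<open>fact n\<close>, which leaves the recurrence of \<open>cycle_mean\<close>.\<close>

lemma sum_cycle_weight:
  assumes "finite S"
  shows "(\<Sum>\<sigma> | \<sigma> permutes S. cycle_weight f S \<sigma>) = fact (card S) * cycle_mean f (card S)"
  using assms
proof (induction S rule: finite_psubset_induct)
  case (psubset S)
  show ?case
  proof (cases "S = {}")
    case True
    then show ?thesis by (simp add: cycle_weight_def)
  next
    case False
    then obtain a where a: "a \<in> S" by auto
    define n where "n = card S - 1"
    have n: "card S = Suc n" using psubset a card_gt_0_iff[of S] by (auto simp: n_def)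
    define g where "g k = fact (k - 1) * f k * (fact (card S - k) * cycle_mean f (card S - k))" for k
    have "(\<Sum>\<sigma> | \<sigma> permutes S. cycle_weight f S \<sigma>) = (\<Sum>C | a \<in> C \<and> C \<subseteq> S. g (card C))"
      unfolding sum_cycle_weight_decompose[OF psubset.hyps a]
    proof (intro sum.cong refl)
      fix C assume C: "C \<in> {C. a \<in> C \<and> C \<subseteq> S}"
      then have "finite C" using psubset finite_subset by auto
      then show "of_nat (card (cyclic_perms a C)) * f (card C)
          * (\<Sum>q | q permutes (S - C). cycle_weight f (S - C) q) = g (card C)"
        using C psubset.IH[of "S - C"] a card_cyclic_perms[of C a]
        by (auto simp: g_def card_Diff_subset)
    qed
    also have "\<dots> = (\<Sum>k\<le>n. (of_nat (n choose k) * (fact k * fact (n - k))) * (f (Suc k) * cycle_mean f (n - k)))"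
      by (subst sum_containing_card[OF psubset.hyps a n]) (simp add: g_def n mult_ac)
    also have "\<dots> = (\<Sum>k\<le>n. fact n * (f (Suc k) * cycle_mean f (n - k)))"
      by (intro sum.cong refl arg_cong2[of _ _ _ _ "(*)"] binomial_fact_complex) auto
    also have "\<dots> = fact (Suc n) * cycle_mean f (Suc n)"
      by (simp add: sum_distrib_left[symmetric] field_simps del: of_nat_Suc)
    finally show ?thesis by (simp add: n)
  qed
qed

section \<open>The characteristic function as a mean of twisted weights\<close>

lemma power_twist_prod:
  assumes "finite A" "\<And>x. x \<in> A \<Longrightarrow> 0 < h x"
  shows "power_twist \<tau> (\<Prod>x\<in>A. h x) = (\<Prod>x\<in>A. power_twist \<tau> (h x))"
  using assms
proof (induction A rule: finite_induct)
  case empty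
  then show ?case by (simp add: power_twist_def)
next
  case (insert x A)
  have "real (\<Prod>x\<in>A. h x) > 0" using insert by (intro of_nat_0_less_iff[THEN iffD2] prod_pos) auto
  then show ?case using insert
    by (simp add: power_twist_def ln_mult distrib_left cis_mult[symmetric])
qed

text \<open>Grouping the cycles by length; each length lies in \<open>{1..n}\<close>, the index
  range of the product.\<close>

lemma cycle_length_product_cycle_count:
  assumes "\<sigma> permutes {1..n}"
  shows "cycle_length_product n (cycle_count n \<sigma>) = (\<Prod>c\<in>orbit \<sigma> ` {1..n}. card c)"
proof -
  let ?X = "orbit \<sigma> ` {1..n}"
  have card: "card c \<in> {1..n}" if c: "c \<in> ?X" for c
  proof -
    obtain x where x: "x \<in> {1..n}" "c = orbit \<sigma> x" using c by blast
    then have "c \<subseteq> {1..n}" using permutes_orbit_subset[OF assms] by auto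
    moreover have "c \<noteq> {}" using x orbit_nonempty[of \<sigma> x] by simp
    ultimately show ?thesis
      using card_mono[of "{1..n}" c] card_gt_0_iff[of c] finite_subset[of c "{1..n}"] by auto
  qed
  have "(\<Prod>c\<in>?X. card c) = (\<Prod>j\<in>{1..n}. \<Prod>c | c \<in> ?X \<and> card c = j. card c)"
    by (rule prod.group[symmetric]) (use card in auto)
  also have "\<dots> = (\<Prod>j\<in>{1..n}. j ^ card {c \<in> ?X. card c = j})"
    by (intro prod.cong refl) simp
  finally show ?thesis by (simp add: cycle_length_product_def cycle_count_def cycles_on_def)
qed

lemma power_twist_cycle_length_product:
  assumes "\<sigma> permutes {1..n}"
  shows "power_twist \<tau> (cycle_length_product n (cycle_count n \<sigma>)) = cycle_weight (power_twist \<tau>) {1..n} \<sigma>"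
  unfolding cycle_length_product_cycle_count[OF assms] cycle_weight_def
proof (rule power_twist_prod)
  fix c assume "c \<in> orbit \<sigma> ` {1..n}"
  then show "0 < card c"
    using permutes_orbit_subset[OF assms] orbit_nonempty[of \<sigma>] finite_subset[of c "{1..n}"]
    by (auto simp: card_gt_0_iff)
qed simp

text \<open>Centring contributes only the unimodular factor \<open>\<omega>\<close>, and scaling
  turns \<open>t\<close> into the frequency \<open>\<tau>\<close>; multiplicativity of the twist
  then makes the integrand a cycle weight.\<close>

lemma norm_log_product_char:
  "norm (log_product_char n t)
     = norm (cycle_mean (power_twist (t * sqrt 3 / ln (real n) powr (3 / 2))) n)"
proof -
  define \<tau> where "\<tau> = t * sqrt 3 / ln (real n) powr (3 / 2)"
  define \<omega> where "\<omega> = cis (- \<tau> * (1 / 2 * (ln (real n))\<^sup>2))"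
  let ?S = "{\<sigma>. \<sigma> permutes {1..n}}"
  have S: "finite ?S" "card ?S = fact n" "?S \<noteq> {}"
    using permutes_id[of "{1..n}"] card_permutations[of "{1..n}" n] by (auto simp: finite_permutations intro: exI[of _ id])
  have iexp: "iexp (t * normalized_log_product n \<sigma>)
      = \<omega> * power_twist \<tau> (cycle_length_product n (cycle_count n \<sigma>))" for \<sigma>
    by (simp add: normalized_log_product_def \<omega>_def power_twist_def \<tau>_def cis_mult cis_conv_exp[symmetric]
        algebra_simps diff_divide_distrib del: of_real_mult of_real_diff)
  have "log_product_char n t = (CLINT \<sigma>|uniform_perm n. iexp (t * normalized_log_product n \<sigma>))"
    unfolding log_product_char_def char_def uniform_perm_def by (subst integral_distr) auto
  also have "\<dots> = (\<Sum>\<sigma>\<in>?S. pmf (pmf_of_set ?S) \<sigma> *\<^sub>R iexp (t * normalized_log_product n \<sigma>))"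
    unfolding uniform_perm_def using S by (intro integral_measure_pmf) auto
  also have "\<dots> = (\<Sum>\<sigma>\<in>?S. \<omega> / fact n * cycle_weight (power_twist \<tau>) {1..n} \<sigma>)"
    using S by (intro sum.cong refl)
      (simp only: iexp, simp add: power_twist_cycle_length_product scaleR_conv_of_real)
  also have "\<dots> = \<omega> * cycle_mean (power_twist \<tau>) n"
    by (subst sum_distrib_left[symmetric], subst sum_cycle_weight) simp_all
  finally show ?thesis by (simp add: norm_mult \<tau>_def \<omega>_def)
qed

section \<open>The recurrence for slowly varying weights\<close>

lemma norm_cis_diff_le: "norm (cis a - cis b) \<le> \<bar>a - b\<bar>"
proof -
  have "cis a - cis b = cis b * (cis (a - b) - 1)"
    by (simp add: algebra_simps cis_mult)
  also have "norm \<dots> = norm (cis (a - b) - 1)"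
    by (simp add: norm_mult)
  also have "\<dots> \<le> \<bar>a - b\<bar>"
    using iexp_approx1[of "a - b" 0] by (simp add: cis_conv_exp norm_minus_commute)
  finally show ?thesis .
qed

lemma norm_power_twist_diff_le:
  "norm (power_twist \<tau> (Suc (Suc k)) - power_twist \<tau> (Suc k)) \<le> \<bar>\<tau>\<bar> / real (Suc k)"
proof -
  have "ln (real (Suc (Suc k))) - ln (real (Suc k)) = ln (1 + 1 / real (Suc k))"
  proof -
    have "1 + 1 / real (Suc k) = real (Suc (Suc k)) / real (Suc k)" by (simp add: field_simps)
    then show ?thesis by (simp add: ln_div del: of_nat_Suc)
  qed
  also have "\<dots> \<le> 1 / real (Suc k)"
    by (rule ln_add_one_self_le_self) simp
  finally have *: "ln (real (Suc (Suc k))) - ln (real (Suc k)) \<le> 1 / real (Suc k)" .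
  have "norm (power_twist \<tau> (Suc (Suc k)) - power_twist \<tau> (Suc k))
      \<le> \<bar>\<tau> * ln (real (Suc (Suc k))) - \<tau> * ln (real (Suc k))\<bar>"
    unfolding power_twist_def by (rule norm_cis_diff_le)
  also have "\<dots> = \<bar>\<tau>\<bar> * (ln (real (Suc (Suc k))) - ln (real (Suc k)))"
    by (simp add: right_diff_distrib[symmetric] abs_mult)
  also have "\<dots> \<le> \<bar>\<tau>\<bar> * (1 / real (Suc k))"
    by (intro mult_left_mono *) auto
  finally show ?thesis by simp
qed

text \<open>Apply 1 + x \<le> exp x to the expanded square of the norm. Keeping \<open>Re w\<close>
  exact, with a merely quadratic error, is what later brings out the cosine sum.\<close>

lemma norm_one_plus_le_exp: "norm (1 + w) \<le> exp (Re w + (norm w)\<^sup>2 / 2)" for w :: complex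
proof -
  have "(norm (1 + w))\<^sup>2 = 1 + (2 * Re w + (norm w)\<^sup>2)"
    unfolding cmod_power2 by (simp add: power2_eq_square algebra_simps)
  also have "\<dots> \<le> exp (2 * Re w + (norm w)\<^sup>2)"
    by (rule exp_ge_add_one_self)
  also have "\<dots> = (exp (Re w + (norm w)\<^sup>2 / 2))\<^sup>2"
    by (simp add: power2_eq_square mult_exp_exp)
  finally show ?thesis
    by (rule power2_le_imp_le) simp
qed

section \<open>Elementary sums and square-root estimates\<close>

lemma harm_conv_sum: "(harm n :: real) = (\<Sum>k<n. 1 / real (Suc k))"
  by (induction n) (simp_all add: harm_Suc inverse_eq_divide harm_expand)

text \<open>Partial fractions: since (k + 1) + (m - k) = m + 1, each term is 1/(k + 1) + 1/(m -
  k).\<close>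

lemma sum_reciprocal_product:
  "(\<Sum>k<m. real (Suc m) / (real (Suc k) * real (m - k))) = 2 * harm m"
proof -
  have "(\<Sum>k<m. real (Suc m) / (real (Suc k) * real (m - k)))
      = (\<Sum>k<m. 1 / real (Suc k) + 1 / real (m - k))"
    by (intro sum.cong refl) (auto simp: field_simps of_nat_diff)
  also have "\<dots> = harm m + (\<Sum>k<m. 1 / real (m - k))"
    by (simp add: sum.distrib harm_conv_sum)
  also have "(\<Sum>k<m. 1 / real (m - k)) = (\<Sum>k<m. 1 / real (Suc k))"
    by (rule sum.reindex_bij_witness[of _ "\<lambda>k. m - Suc k" "\<lambda>k. m - Suc k"]) auto
  finally show ?thesis by (simp add: harm_conv_sum)
qed

lemma sum_inverse_sqrt_le: "(\<Sum>k<m. 1 / sqrt (real (Suc k))) \<le> 2 * sqrt (real m)"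
proof (induction m)
  case (Suc m)
  have "1 / sqrt (real (Suc m)) \<le> 2 * (sqrt (real (Suc m)) - sqrt (real m))"
  proof -
    define a b where "a = sqrt (real (Suc m))" and "b = sqrt (real m)"
    have ab: "a > 0" "b \<ge> 0" "a\<^sup>2 = b\<^sup>2 + 1" "b \<le> a" by (auto simp: a_def b_def)
    have "1 = (a - b) * (a + b)" using ab by (simp add: algebra_simps power2_eq_square)
    also have "\<dots> \<le> (a - b) * (2 * a)" using ab by (intro mult_left_mono) auto
    finally have "1 / a \<le> 2 * (a - b)" using ab(1) by (simp add: divide_le_eq mult_ac)
    then show ?thesis by (simp add: a_def b_def)
  qed
  with Suc show ?case by simp
qed simp

text \<open>From s to s + 1 the square root grows by a relative amount of about 1/(2s), which
  outweighs a relative loss of A/s when A \<le> 1/4. The worst case A = 1/4 is checked by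
  squaring.\<close>

lemma sqrt_step_le:
  assumes "s \<ge> (1 :: real)" "0 \<le> A" "A \<le> 1 / 4"
  shows "sqrt s \<le> sqrt (s + 1) * (1 - A / s)"
proof (rule order_trans[OF real_le_lsqrt[where y = "sqrt (s + 1) * (1 - 1 / (4 * s))"]])
  show "sqrt (s + 1) * (1 - 1 / (4 * s)) \<le> sqrt (s + 1) * (1 - A / s)"
    using assms by (intro mult_left_mono) (auto simp: field_simps)
  have "(sqrt (s + 1) * (1 - 1 / (4 * s)))\<^sup>2 = (s + 1) * (1 - 1 / (4 * s))\<^sup>2"
    using assms by (simp add: power_mult_distrib)
  also have "\<dots> = s + 1 / 2 - 7 / (16 * s) + 1 / (16 * s\<^sup>2)"
    using assms by (simp add: field_simps power2_eq_square)
  also have "\<dots> \<ge> s"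
  proof -
    have "7 / (16 * s) \<le> 1 / 2" "0 \<le> 1 / (16 * s\<^sup>2)" using assms by (simp_all add: divide_le_eq)
    then show ?thesis by linarith
  qed
  finally show "s \<le> (sqrt (s + 1) * (1 - 1 / (4 * s)))\<^sup>2" .
qed (use assms in \<open>auto simp: field_simps\<close>)

text \<open>With a, b the two roots, b^2 - a^2 = 1 gives 1/a - 1/b = 1/(a b (a + b)), and b (a + b)
  \<le> 2 b^2 \<le> 4 a^2.\<close>

lemma sqrt_telescope_le:
  assumes "s \<ge> (1 :: real)"
  shows "1 / (s * sqrt s) \<le> 4 * (1 / sqrt s - 1 / sqrt (s + 1))"
proof -
  define a b where "a = sqrt s" and "b = sqrt (s + 1)"
  have ab: "a \<ge> 1" "b > 0" "b\<^sup>2 = a\<^sup>2 + 1" "a \<le> b" "s = a\<^sup>2" "b\<^sup>2 = s + 1"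
    using assms by (auto simp: a_def b_def)
  have a2: "a\<^sup>2 \<ge> 1" using ab assms by simp
  have "b * (a + b) \<le> b * (2 * b)" using ab by (intro mult_left_mono) auto
  also have "\<dots> = 2 * a\<^sup>2 + 2" using ab(3) by (simp add: power2_eq_square)
  also have "\<dots> \<le> 4 * a\<^sup>2" using a2 by simp
  finally have 1: "b * (a + b) \<le> 4 * a\<^sup>2" .
  have "a + b > 0" using ab by simp
  then have "1 / a - 1 / b = (b - a) * (b + a) / (a * b * (a + b))"
    using ab(1,2) by (simp add: diff_frac_eq mult.commute[of _ "a + b"] add.commute[of b a])
  also have "(b - a) * (b + a) = 1" using ab(3) by (simp add: algebra_simps power2_eq_square)
  finally have 2: "1 / a - 1 / b = 1 / (a * (b * (a + b)))" by (simp add: mult.assoc)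
  have "1 / (a\<^sup>2 * a) = 4 * (1 / (a * (4 * a\<^sup>2)))" by (simp add: field_simps)
  also have "\<dots> \<le> 4 * (1 / (a * (b * (a + b))))"
    using 1 ab by (intro mult_left_mono divide_left_mono mult_pos_pos) auto
  also have "\<dots> = 4 * (1 / a - 1 / b)" by (simp only: 2)
  finally have "1 / (s * a) \<le> 4 * (1 / a - 1 / b)" by (simp only: ab(5))
  then show ?thesis unfolding a_def b_def .
qed

text \<open>Small relative steps cannot undo the growth of the square root. This bounds earlier
  values by the last one, the direction needed when the recurrence expresses a new term through old
  ones.\<close>

lemma slowly_varying_mono:
  fixes x :: "nat \<Rightarrow> complex"
  assumes A: "0 \<le> A" "A \<le> 1 / 4" and "i \<le> m"
    and step: "\<And>i. i < m \<Longrightarrow> norm (x (Suc i) - x i) \<le> A / real (Suc i) * norm (x i)"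
  shows "sqrt (real (Suc i)) * norm (x i) \<le> sqrt (real (Suc m)) * norm (x m)"
  using \<open>i \<le> m\<close>
proof (induction i rule: inc_induct)
  case (step i)
  have "sqrt (real (Suc i)) * norm (x i) \<le> sqrt (real (Suc i) + 1) * (1 - A / real (Suc i)) * norm (x i)"
    using A by (intro mult_right_mono sqrt_step_le) auto
  also have "\<dots> = sqrt (real (Suc (Suc i))) * (norm (x i) - A / real (Suc i) * norm (x i))"
    by (simp add: algebra_simps)
  also have "\<dots> \<le> sqrt (real (Suc (Suc i))) * norm (x (Suc i))"
    using assms(4)[OF step(2)] norm_triangle_ineq2[of "x i" "x (Suc i)"]
    by (intro mult_left_mono) (auto simp: norm_minus_commute)
  finally show ?case using step.IH by linarith
qed simp

text \<open>By \<open>slowly_varying_mono\<close> the increment at s = i + 1 is at most a multiple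
  of s^(-3/2) times the last value; descending from \<open>m\<close>, these bounds
  telescope.\<close>

lemma slowly_varying_diff_le:
  fixes x :: "nat \<Rightarrow> complex"
  assumes A: "0 \<le> A" "A \<le> 1 / 4" and "i \<le> m"
    and step: "\<And>i. i < m \<Longrightarrow> norm (x (Suc i) - x i) \<le> A / real (Suc i) * norm (x i)"
  shows "norm (x i - x m) \<le> 4 * A * (sqrt (real (Suc m)) / sqrt (real (Suc i)) - 1) * norm (x m)"
  using \<open>i \<le> m\<close>
proof (induction i rule: inc_induct)
  case (step i)
  define s where "s = real (Suc i)"
  have s: "s \<ge> 1" "s + 1 = real (Suc (Suc i))" by (auto simp: s_def)
  have "sqrt s * norm (x i) \<le> sqrt (real (Suc m)) * norm (x m)"
    unfolding s_def by (rule slowly_varying_mono[OF A _ assms(4)]) (use step in auto)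
  then have *: "norm (x i) \<le> sqrt (real (Suc m)) * norm (x m) / sqrt s"
    using s by (simp add: field_simps)
  have "norm (x (Suc i) - x i) \<le> A / s * norm (x i)"
    unfolding s_def by (rule assms(4)) (rule step)
  also have "\<dots> \<le> A / s * (sqrt (real (Suc m)) * norm (x m) / sqrt s)"
    using A s by (intro mult_left_mono *) auto
  also have "\<dots> = A * sqrt (real (Suc m)) * norm (x m) * (1 / (s * sqrt s))"
    by simp
  also have "\<dots> \<le> A * sqrt (real (Suc m)) * norm (x m) * (4 * (1 / sqrt s - 1 / sqrt (s + 1)))"
    using A s by (intro mult_left_mono sqrt_telescope_le) auto
  finally have 1: "norm (x (Suc i) - x i) \<le> \<dots>" .
  have "norm (x i - x m) \<le> norm (x (Suc i) - x i) + norm (x (Suc i) - x m)"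
    using norm_triangle_ineq4[of "x (Suc i) - x m" "x (Suc i) - x i"] by simp
  also have "\<dots> \<le> A * sqrt (real (Suc m)) * norm (x m) * (4 * (1 / sqrt s - 1 / sqrt (s + 1)))
      + 4 * A * (sqrt (real (Suc m)) / sqrt (s + 1) - 1) * norm (x m)"
    unfolding s(2) using 1[unfolded s(2)] step.IH by (rule add_mono)
  also have "\<dots> = 4 * A * (sqrt (real (Suc m)) / sqrt s - 1) * norm (x m)"
    by (simp add: algebra_simps)
  finally show ?case unfolding s_def .
qed simp

text \<open>A bootstrap: the step bound below \<open>m\<close> compares all earlier means with
  \<open>M m\<close>. Inserted into \<open>cycle_mean_difference\<close>, this leaves
  \<open>2 * \<bar>\<tau>\<bar> * harm m\<close>, which is at most \<open>A\<close>, so the bound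
  reproduces itself at \<open>m\<close>.\<close>

lemma cycle_mean_power_twist_step:
  assumes "2 * \<bar>\<tau>\<bar> * harm n \<le> A" "A \<le> 1 / 4" "m \<le> n"
  shows "norm (cycle_mean (power_twist \<tau>) (Suc m) - cycle_mean (power_twist \<tau>) m)
           \<le> A / real (Suc m) * norm (cycle_mean (power_twist \<tau>) m)"
  using \<open>m \<le> n\<close>
proof (induction m rule: less_induct)
  case (less m)
  define M where "M = cycle_mean (power_twist \<tau>)"
  have "0 \<le> 2 * \<bar>\<tau>\<bar> * harm n" by (simp add: harm_nonneg)
  then have A0: "A \<ge> 0" using assms(1) by linarith
  have mono: "sqrt (real (Suc i)) * norm (M i) \<le> sqrt (real (Suc m)) * norm (M m)" if "i \<le> m" for i
    by (rule slowly_varying_mono[OF A0 assms(2) that]) (use less in \<open>auto simp: M_def\<close>)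
  have "real (Suc m) * norm (M (Suc m) - M m) = norm (of_nat (Suc m) * (M (Suc m) - M m))"
    by (simp only: norm_mult norm_of_nat)
  also have "\<dots> = norm (\<Sum>k<m. (power_twist \<tau> (Suc (Suc k)) - power_twist \<tau> (Suc k)) * M (m - Suc k))"
    unfolding M_def by (subst cycle_mean_difference) simp_all
  also have "\<dots> \<le> (\<Sum>k<m. \<bar>\<tau>\<bar> * (real (Suc m) / (real (Suc k) * real (m - k))) * norm (M m))"
  proof (rule sum_norm_le)
    fix k assume k: "k \<in> {..<m}"
    have "Suc (m - Suc k) = m - k" using k by auto
    then have "norm (M (m - Suc k)) \<le> sqrt (real (Suc m)) / sqrt (real (m - k)) * norm (M m)"
      using mono[of "m - Suc k"] k by (simp add: field_simps)
    also have "\<dots> = sqrt (real (Suc m) / real (m - k)) * norm (M m)"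
      by (simp add: real_sqrt_divide)
    \<comment> \<open>Dropping the square root loses nothing that matters and produces exactly the
      summands of \<open>sum_reciprocal_product\<close>.\<close>
    also have "\<dots> \<le> real (Suc m) / real (m - k) * norm (M m)"
    proof (intro mult_right_mono)
      have "real (Suc m) / real (m - k) \<ge> 1" using k by (simp add: field_simps)
      then show "sqrt (real (Suc m) / real (m - k)) \<le> real (Suc m) / real (m - k)"
        by (intro real_le_lsqrt self_le_power) auto
    qed auto
    finally have *: "norm (M (m - Suc k)) \<le> real (Suc m) / real (m - k) * norm (M m)" .
    show "norm ((power_twist \<tau> (Suc (Suc k)) - power_twist \<tau> (Suc k)) * M (m - Suc k))
        \<le> \<bar>\<tau>\<bar> * (real (Suc m) / (real (Suc k) * real (m - k))) * norm (M m)"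
      unfolding norm_mult
      by (rule order_trans[OF mult_mono[OF norm_power_twist_diff_le *]]) auto
  qed
  also have "\<dots> = 2 * \<bar>\<tau>\<bar> * harm m * norm (M m)"
    by (simp only: sum_distrib_left[symmetric] sum_distrib_right[symmetric]
        sum_reciprocal_product mult_ac)
  also have "\<dots> \<le> A * norm (M m)"
  proof (rule mult_right_mono)
    have "2 * \<bar>\<tau>\<bar> * harm m \<le> 2 * \<bar>\<tau>\<bar> * harm n"
      using less.prems by (intro mult_left_mono harm_mono) auto
    then show "2 * \<bar>\<tau>\<bar> * harm m \<le> A" using assms(1) by linarith
  qed simp
  finally show ?case by (simp add: M_def field_simps del: cycle_mean.simps)
qed

text \<open>Replacing each earlier mean by \<open>M m\<close> in the difference recurrence makes the
  weights telescope to the main term. The error has no logarithm: the deviation of the earlier mean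
  contains a factor that cancels the denominator \<open>Suc k\<close> of the weight
  difference.\<close>

lemma cycle_mean_power_twist_step_refined:
  assumes "2 * \<bar>\<tau>\<bar> * harm n \<le> A" "A \<le> 1 / 4" "m \<le> n"
  defines "M \<equiv> cycle_mean (power_twist \<tau>)"
  shows "norm (of_nat (Suc m) * (M (Suc m) - M m) - (power_twist \<tau> (Suc m) - 1) * M m)
           \<le> 8 * A * \<bar>\<tau>\<bar> * norm (M m)"
proof -
  define f where "f = power_twist \<tau>"
  have "0 \<le> 2 * \<bar>\<tau>\<bar> * harm n" by (simp add: harm_nonneg)
  then have A0: "A \<ge> 0" using assms(1) by linarith
  have tele: "(\<Sum>k<m. f (Suc (Suc k)) - f (Suc k)) = f (Suc m) - 1"
    by (induction m) (simp_all add: f_def)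
  have "of_nat (Suc m) * (M (Suc m) - M m) - (f (Suc m) - 1) * M m
      = (\<Sum>k<m. (f (Suc (Suc k)) - f (Suc k)) * (M (m - Suc k) - M m))"
    unfolding M_def f_def[symmetric]
    by (subst cycle_mean_difference)
       (simp_all add: tele[symmetric] sum_distrib_right sum_subtractf[symmetric] right_diff_distrib
           del: sum_subtractf, simp add: f_def)
  also have "norm \<dots> \<le> (\<Sum>k<m. \<bar>\<tau>\<bar> * (4 * A) * norm (M m) * (1 / sqrt (real (Suc m)) * (1 / sqrt (real (m - k)))))"
  proof (rule sum_norm_le)
    fix k assume k: "k \<in> {..<m}"
    \<comment> \<open>\<open>q - r\<close> is the denominator \<open>Suc k\<close> of the weight
      difference; it factors as (sqrt q - sqrt r)(sqrt q + sqrt r), and the first factor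
      cancels.\<close>
    define q r where "q = real (Suc m)" and "r = real (m - k)"
    have qr: "q - r = real (Suc k)" "r > 0" "r < q" using k by (auto simp: q_def r_def)
    have "Suc (m - Suc k) = m - k" using k by auto
    then have *: "norm (M (m - Suc k) - M m) \<le> 4 * A * (sqrt q / sqrt r - 1) * norm (M m)"
      using slowly_varying_diff_le[OF A0 assms(2), of "m - Suc k" m M] 
        cycle_mean_power_twist_step[OF assms(1,2)] assms(3) unfolding M_def q_def r_def by simp
    have "norm ((f (Suc (Suc k)) - f (Suc k)) * (M (m - Suc k) - M m))
        \<le> \<bar>\<tau>\<bar> / (q - r) * (4 * A * (sqrt q / sqrt r - 1) * norm (M m))"
      unfolding norm_mult f_def qr(1) by (intro mult_mono * norm_power_twist_diff_le) auto
    also have "\<dots> = \<bar>\<tau>\<bar> * (4 * A) * norm (M m) * ((sqrt q / sqrt r - 1) / (q - r))"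
      by simp
    also have "\<dots> \<le> \<bar>\<tau>\<bar> * (4 * A) * norm (M m) * (1 / sqrt q * (1 / sqrt r))"
    proof (intro mult_left_mono)
      have "q - r = (sqrt q - sqrt r) * (sqrt q + sqrt r)" using qr by (simp add: algebra_simps)
      moreover have "sqrt q / sqrt r - 1 = (sqrt q - sqrt r) / sqrt r" using qr by (simp add: diff_divide_distrib)
      ultimately have "(sqrt q / sqrt r - 1) / (q - r) = 1 / (sqrt q + sqrt r) * (1 / sqrt r)"
        using qr by simp
      also have "\<dots> \<le> 1 / sqrt q * (1 / sqrt r)"
        using qr by (intro mult_right_mono divide_left_mono mult_pos_pos add_pos_pos) auto
      finally show "(sqrt q / sqrt r - 1) / (q - r) \<le> 1 / sqrt q * (1 / sqrt r)" .
    qed (use A0 in auto)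
    finally show "norm ((f (Suc (Suc k)) - f (Suc k)) * (M (m - Suc k) - M m))
        \<le> \<bar>\<tau>\<bar> * (4 * A) * norm (M m) * (1 / sqrt (real (Suc m)) * (1 / sqrt (real (m - k))))"
      by (simp add: q_def r_def)
  qed
  also have "\<dots> = \<bar>\<tau>\<bar> * (4 * A) * norm (M m) * (1 / sqrt (real (Suc m)) * (\<Sum>k<m. 1 / sqrt (real (m - k))))"
    by (simp only: sum_distrib_left)
  also have "(\<Sum>k<m. 1 / sqrt (real (m - k))) = (\<Sum>k<m. 1 / sqrt (real (Suc k)))"
    by (rule sum.reindex_bij_witness[of _ "\<lambda>k. m - Suc k" "\<lambda>k. m - Suc k"]) auto
  also have "\<bar>\<tau>\<bar> * (4 * A) * norm (M m) * (1 / sqrt (real (Suc m)) * \<dots>)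
      \<le> \<bar>\<tau>\<bar> * (4 * A) * norm (M m) * (1 / sqrt (real (Suc m)) * (2 * sqrt (real (Suc m))))"
    using A0 by (intro mult_left_mono order_trans[OF sum_inverse_sqrt_le]) auto
  also have "\<dots> = 8 * A * \<bar>\<tau>\<bar> * norm (M m)"
    by simp
  finally show ?thesis by (simp add: f_def)
qed

text \<open>Each ratio of consecutive means is 1 + w. The refined step controls \<open>Re w\<close>,
  the coarse step gives |w| \<le> 1/(m + 1), and \<open>norm_one_plus_le_exp\<close> turns the
  product of ratios into the exponential of a sum.\<close>

lemma cycle_mean_power_twist_le_exp:
  assumes "2 * \<bar>\<tau>\<bar> * harm n \<le> 1 / 4" "m \<le> n"
  shows "norm (cycle_mean (power_twist \<tau>) m)
    \<le> exp (\<Sum>k<m. (cos (\<tau> * ln (real (Suc k))) - 1) / real (Suc k)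
              + 2 * \<bar>\<tau>\<bar> / real (Suc k) + 1 / (real (Suc k))\<^sup>2)"
  using assms(2)
proof (induction m)
  case (Suc m)
  define M where "M = cycle_mean (power_twist \<tau>)"
  define c where "c = cos (\<tau> * ln (real (Suc m))) - 1"
  show ?case
  proof (cases "M m = 0")
    \<comment> \<open>The step bound is relative to \<open>M m\<close>, so a vanishing mean forces
      the next one to vanish.\<close>
    case True
    then show ?thesis
      using cycle_mean_power_twist_step[OF assms(1), of m] Suc.prems
      by (simp add: M_def del: cycle_mean.simps)
  next
    case False
    define w where "w = (M (Suc m) - M m) / M m"
    have w: "M (Suc m) = M m * (1 + w)" using False by (simp add: w_def field_simps)
    have "norm w \<le> 1 / 4 / real (Suc m)"
      using cycle_mean_power_twist_step[OF assms(1), of m] Suc.prems False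
      unfolding w_def M_def[symmetric] by (simp add: norm_divide divide_le_eq)
    also have "\<dots> \<le> 1 / real (Suc m)" by (simp add: field_simps)
    finally have "(norm w)\<^sup>2 \<le> (1 / real (Suc m))\<^sup>2" by (intro power_mono) auto
    then have w2: "(norm w)\<^sup>2 / 2 \<le> 1 / (real (Suc m))\<^sup>2"
      using zero_le_power2[of "norm w"] unfolding power_divide power_one by linarith
    have "norm (of_nat (Suc m) * w - (power_twist \<tau> (Suc m) - 1)) * norm (M m)
      = norm (of_nat (Suc m) * (M (Suc m) - M m) - (power_twist \<tau> (Suc m) - 1) * M m)"
    proof -
      have "w * M m = M (Suc m) - M m" using False by (simp add: w_def)
      then have "(of_nat (Suc m) * w - (power_twist \<tau> (Suc m) - 1)) * M m
          = of_nat (Suc m) * (M (Suc m) - M m) - (power_twist \<tau> (Suc m) - 1) * M m"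
        by (simp only: left_diff_distrib mult.assoc)
      then show ?thesis by (simp only: norm_mult[symmetric])
    qed
    \<comment> \<open>The constant is \<open>8 * A\<close> with \<open>A = 1 / 4\<close>.\<close>
    also have "\<dots> \<le> 2 * \<bar>\<tau>\<bar> * norm (M m)"
      using cycle_mean_power_twist_step_refined[OF assms(1), of m] Suc.prems
      unfolding M_def[symmetric] by simp
    finally have "norm (of_nat (Suc m) * w - (power_twist \<tau> (Suc m) - 1)) \<le> 2 * \<bar>\<tau>\<bar>"
      using False by simp
    then have "Re (of_nat (Suc m) * w - (power_twist \<tau> (Suc m) - 1)) \<le> 2 * \<bar>\<tau>\<bar>"
      using complex_Re_le_cmod order_trans by blast
    then have "real (Suc m) * Re w \<le> c + 2 * \<bar>\<tau>\<bar>"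
      by (simp add: power_twist_def c_def)
    then have "Re w \<le> (c + 2 * \<bar>\<tau>\<bar>) / real (Suc m)"
      by (simp add: field_simps)
    then have "Re w + (norm w)\<^sup>2 / 2 \<le> c / real (Suc m) + 2 * \<bar>\<tau>\<bar> / real (Suc m) + 1 / (real (Suc m))\<^sup>2"
      using w2 by (simp add: add_divide_distrib)
    then have "norm (1 + w) \<le> exp (c / real (Suc m) + 2 * \<bar>\<tau>\<bar> / real (Suc m) + 1 / (real (Suc m))\<^sup>2)"
      using norm_one_plus_le_exp[of w] by (meson exp_le_cancel_iff order_trans)
    then have "norm (M m) * norm (1 + w) \<le> exp (\<Sum>k<m. (cos (\<tau> * ln (real (Suc k))) - 1) / real (Suc k)
              + 2 * \<bar>\<tau>\<bar> / real (Suc k) + 1 / (real (Suc k))\<^sup>2)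
        * exp (c / real (Suc m) + 2 * \<bar>\<tau>\<bar> / real (Suc m) + 1 / (real (Suc m))\<^sup>2)"
      using Suc unfolding M_def by (intro mult_mono) auto
    then show ?thesis
      unfolding M_def[symmetric] w norm_mult c_def by (simp add: exp_add)
  qed
qed simp

section \<open>Sums of the cosine of a logarithm\<close>

text \<open>Taylor expansion with remainder x^5/120; on [0, 2] this remainder is at most x^3/30, and
  1/6 - 1/30 = 2/15.\<close>

lemma sin_le_cubic:
  fixes x :: real
  assumes "0 \<le> x" "x \<le> 2"
  shows "sin x \<le> x * (1 - 2 / 15 * x\<^sup>2)"
proof -
  have "\<bar>sin x - (\<Sum>m<5. sin_coeff m * x ^ m)\<bar> \<le> inverse (fact 5) * \<bar>x\<bar> ^ 5"
    by (rule Maclaurin_sin_bound)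
  moreover have "(\<Sum>m<5. sin_coeff m * x ^ m) = x - x ^ 3 / 6"
    by (simp add: sin_coeff_def lessThan_nat_numeral fact_numeral)
  moreover have "inverse (fact 5) * \<bar>x\<bar> ^ 5 = x ^ 3 * x\<^sup>2 / 120"
    using assms by (simp add: fact_numeral power2_eq_square power3_eq_cube numeral_eq_Suc)
  moreover have "x ^ 3 * x\<^sup>2 \<le> x ^ 3 * 4"
    using assms power_mono[of x 2 2] by (intro mult_left_mono) auto
  moreover have "x * (1 - 2 / 15 * x\<^sup>2) = x - 2 / 15 * x ^ 3"
    by (simp add: algebra_simps power2_eq_square power3_eq_cube)
  ultimately show ?thesis by linarith
qed

text \<open>Up to 2 the cubic bound applies; beyond 2 one has sin x \<le> 1 < x/2, and the bracket
  is at least 1/2.\<close>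

lemma sin_le_mult_of_ge:
  fixes x c :: real
  assumes "0 < c" "c \<le> 1" "c \<le> x"
  shows "sin x \<le> x * (1 - 2 / 15 * c\<^sup>2)"
proof (cases "x \<le> 2")
  case True
  have "c\<^sup>2 \<le> x\<^sup>2" using assms by (intro power_mono) auto
  then have "x * (1 - 2 / 15 * x\<^sup>2) \<le> x * (1 - 2 / 15 * c\<^sup>2)"
    using assms by (intro mult_left_mono) auto
  with sin_le_cubic[of x] True assms show ?thesis by linarith
next
  case False
  have "c\<^sup>2 \<le> 1" using assms by (simp add: power_le_one)
  then have "x * (1 / 2) \<le> x * (1 - 2 / 15 * c\<^sup>2)"
    using assms by (intro mult_left_mono) auto
  moreover have "sin x \<le> 1" by simp
  ultimately show ?thesis using False by linarith
qed

lemma abs_cos_diff_le: "\<bar>cos a - cos b\<bar> \<le> \<bar>a - b\<bar>" for a b :: real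
  using norm_cis_diff_le[of a b] abs_Re_le_cmod[of "cis a - cis b"] by simp

text \<open>sin(\<tau> ln x)/\<tau> is an antiderivative of cos(\<tau> ln x)/x, and each summand
  differs from the increment of it by at most 3/N - 3/(N + 1). The term -3/N lets the induction
  absorb this error; 4 makes N = 1 an equality.\<close>

lemma cos_ln_sum_le:
  assumes "0 < \<tau>" "\<tau> \<le> 2" "1 \<le> N"
  shows "(\<Sum>k<N. cos (\<tau> * ln (real (Suc k))) / real (Suc k)) \<le> sin (\<tau> * ln (real N)) / \<tau> + 4 - 3 / real N"
  using \<open>1 \<le> N\<close>
proof (induction N rule: nat_induct_at_least)
  case (Suc N)
  define a b where "a = real N" and "b = real (Suc N)"
  have ab: "a \<ge> 1" "b = a + 1" using Suc by (auto simp: a_def b_def)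
  have "\<exists>x. a < x \<and> x < b \<and> sin (\<tau> * ln b) / \<tau> - sin (\<tau> * ln a) / \<tau> = (b - a) * (cos (\<tau> * ln x) / x)"
    by (rule MVT2) (use ab assms in \<open>auto intro!: derivative_eq_intros simp: field_simps\<close>)
  then obtain x where x: "a < x" "x < b"
    and eq: "sin (\<tau> * ln b) / \<tau> - sin (\<tau> * ln a) / \<tau> = cos (\<tau> * ln x) / x"
    using ab by auto
  have "ln b - ln x = ln (b / x)" using x ab by (simp add: ln_div)
  also have "\<dots> \<le> b / x - 1" using x ab by (intro ln_le_minus_one) auto
  also have "\<dots> = (b - x) / x" using x ab by (simp add: diff_divide_distrib)
  also have "\<dots> \<le> 1 / a" using x ab by (intro frac_le) auto
  finally have ln: "ln b - ln x \<le> 1 / a" .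
  have "cos (\<tau> * ln b) - cos (\<tau> * ln x) \<le> \<bar>\<tau> * ln b - \<tau> * ln x\<bar>"
    using abs_cos_diff_le[of "\<tau> * ln b" "\<tau> * ln x"] by linarith
  also have "\<dots> = \<tau> * (ln b - ln x)"
    using x ab assms by (simp add: right_diff_distrib[symmetric] abs_mult)
  also have "\<dots> \<le> 2 * (1 / a)" using ln x ab assms by (intro mult_mono) auto
  finally have cos: "cos (\<tau> * ln b) - cos (\<tau> * ln x) \<le> 2 / a" by simp
  have "cos (\<tau> * ln b) / b - cos (\<tau> * ln x) / x
      = (cos (\<tau> * ln b) - cos (\<tau> * ln x)) / b - cos (\<tau> * ln x) * (1 / x - 1 / b)"
    by (simp add: diff_divide_distrib right_diff_distrib)
  \<comment> \<open>The first term comes from the change of the cosine, using \<tau> \<le> 2, the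
    second from the change of the weight 1/x. As b = a + 1, 1/(a b) is 1/a - 1/b, which gives the
    total factor 3.\<close>
  also have "\<dots> \<le> 2 / a / b + (1 / a - 1 / b)"
  proof -
    have "- cos (\<tau> * ln x) * (1 / x - 1 / b) \<le> 1 * (1 / a - 1 / b)"
      using x ab by (intro mult_mono diff_mono divide_left_mono) (use x ab cos_ge_minus_one[of "\<tau> * ln x"] in \<open>auto simp: mult_pos_pos minus_le_iff intro: divide_left_mono\<close>)
    moreover have "(cos (\<tau> * ln b) - cos (\<tau> * ln x)) / b \<le> 2 / a / b"
      using cos ab by (intro divide_right_mono) auto
    ultimately show ?thesis
      by (simp only: mult_minus_left mult_1)
  qed
  also have "\<dots> = 3 / a - 3 / b" using ab by (simp add: field_simps)
  finally have "cos (\<tau> * ln b) / b \<le> cos (\<tau> * ln x) / x + 3 / a - 3 / b" by linarith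
  then show ?case using Suc.IH eq unfolding a_def[symmetric] b_def[symmetric]
    by (simp add: a_def[symmetric] b_def[symmetric] del: of_nat_Suc)
qed auto

lemma harm_le_ln_plus_1:
  assumes "1 \<le> n"
  shows "(harm n :: real) \<le> ln (real n) + 1"
  using assms
proof (induction n rule: nat_induct_at_least)
  case (Suc n)
  define a where "a = real n"
  have a: "a \<ge> 1" using Suc by (simp add: a_def)
  have "ln (a / (a + 1)) \<le> a / (a + 1) - 1" using a by (intro ln_le_minus_one) auto
  also have "\<dots> = - inverse (a + 1)" using a by (simp add: field_simps)
  finally have "ln a + inverse (a + 1) \<le> ln (a + 1)" using a by (simp add: ln_div)
  then show ?case using Suc by (simp add: harm_Suc a_def add.commute)
qed (simp add: harm_expand)

section \<open>The generating polynomial on the unit circle\<close>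

text \<open>Summation by parts, with the boundary term kept on the left so that raising
  \<open>m\<close> adds just one difference of coefficients.\<close>

lemma abel_summation_bound:
  fixes h :: "nat \<Rightarrow> complex"
  assumes "N \<le> m" "norm z = 1"
  shows "norm ((1 - z) * (\<Sum>k\<in>{N..m}. h k * z ^ k) + h m * z ^ Suc m)
          \<le> norm (h N) + (\<Sum>k\<in>{N..<m}. norm (h (Suc k) - h k))"
  using \<open>N \<le> m\<close>
proof (induction m rule: dec_induct)
  case base
  show ?case using assms by (simp add: algebra_simps norm_mult norm_power)
next
  case (step m)
  have "(1 - z) * (\<Sum>k\<in>{N..Suc m}. h k * z ^ k) + h (Suc m) * z ^ Suc (Suc m)
      = ((1 - z) * (\<Sum>k\<in>{N..m}. h k * z ^ k) + h m * z ^ Suc m) + (h (Suc m) - h m) * z ^ Suc m"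
    using step by (simp add: algebra_simps)
  also have "norm \<dots> \<le> norm (h N) + (\<Sum>k\<in>{N..<m}. norm (h (Suc k) - h k)) + norm ((h (Suc m) - h m) * z ^ Suc m)"
    by (rule order_trans[OF norm_triangle_ineq add_right_mono[OF step.IH]])
  also have "\<dots> = norm (h N) + (\<Sum>k\<in>{N..<Suc m}. norm (h (Suc k) - h k))"
    using step assms by (simp add: norm_mult norm_power)
  finally show ?case .
qed

definition cycle_polynomial :: "(nat \<Rightarrow> complex) \<Rightarrow> nat \<Rightarrow> complex \<Rightarrow> complex" where
  "cycle_polynomial f n z = (\<Sum>k<n. f (Suc k) / of_nat (Suc k) * z ^ Suc k)"

definition cycle_polynomial_deriv :: "(nat \<Rightarrow> complex) \<Rightarrow> nat \<Rightarrow> complex \<Rightarrow> complex" where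
  "cycle_polynomial_deriv f n z = (\<Sum>k<n. f (Suc k) * z ^ k)"

lemma has_field_derivative_cycle_polynomial:
  "(cycle_polynomial f n has_field_derivative cycle_polynomial_deriv f n z) (at z)"
  unfolding cycle_polynomial_def[abs_def] cycle_polynomial_deriv_def
proof (rule DERIV_sum)
  fix k
  have "((\<lambda>z. f (Suc k) / of_nat (Suc k) * z ^ Suc k) has_field_derivative
      f (Suc k) / of_nat (Suc k) * (of_nat (Suc k) * z ^ k)) (at z)"
    by (intro DERIV_cmult) (rule derivative_eq_intros refl | simp)+
  then show "((\<lambda>z. f (Suc k) / of_nat (Suc k) * z ^ Suc k) has_field_derivative
      f (Suc k) * z ^ k) (at z)"
    by (simp del: of_nat_Suc)
qed

text \<open>Written as a telescoping difference, so that the total variation needed for Abel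
  summation can be summed at once.\<close>

lemma norm_power_twist_quotient_diff_le:
  assumes "\<bar>\<tau>\<bar> \<le> 2"
  shows "norm (power_twist \<tau> (Suc (Suc k)) / of_nat (Suc (Suc k)) - power_twist \<tau> (Suc k) / of_nat (Suc k))
           \<le> 3 * (1 / real (Suc k) - 1 / real (Suc (Suc k)))"
proof -
  define p q where "p = power_twist \<tau> (Suc (Suc k))" and "q = power_twist \<tau> (Suc k)"
  define a b where "a = real (Suc k)" and "b = real (Suc (Suc k))"
  have ab: "a > 0" "b = a + 1" by (auto simp: a_def b_def)
  have "p / of_real b - q / of_real a = (p - q) / of_real b - q * of_real (1 / a - 1 / b)"
    by (simp add: diff_divide_distrib right_diff_distrib)
  also have "norm \<dots> \<le> norm ((p - q) / of_real b) + norm (q * of_real (1 / a - 1 / b))"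
    by (rule norm_triangle_ineq4)
  also have "\<dots> = norm (p - q) / b + \<bar>1 / a - 1 / b\<bar>"
    using ab by (simp add: norm_divide norm_mult q_def del: of_real_diff of_real_divide)
  also have "\<dots> \<le> (2 / a) / b + (1 / a - 1 / b)"
  proof (intro add_mono divide_right_mono)
    have "norm (p - q) \<le> \<bar>\<tau>\<bar> / a" unfolding p_def q_def a_def by (rule norm_power_twist_diff_le)
    also have "\<dots> \<le> 2 / a" using assms ab by (intro divide_right_mono) auto
    finally show "norm (p - q) \<le> 2 / a" .
  qed (use ab in \<open>auto simp: field_simps\<close>)
  also have "\<dots> = 3 * (1 / a - 1 / b)" using ab by (simp add: field_simps)
  finally show ?thesis by (simp add: a_def b_def p_def q_def)
qed

text \<open>Cut the polynomial at N of size about 1/|1 - z|, or at n if that is reached first. Below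
  the cut powers of z are close to 1, at a cost of at most 1; above it Abel summation bounds the
  oscillating tail by 4.\<close>

lemma Re_cycle_polynomial_le:
  assumes \<tau>: "\<bar>\<tau>\<bar> \<le> 2" and z: "norm z = 1"
  shows "\<exists>N\<le>n. Re (cycle_polynomial (power_twist \<tau>) n z)
           \<le> (\<Sum>k<N. cos (\<tau> * ln (real (Suc k))) / real (Suc k)) + 5"
proof -
  define h where "h k = power_twist \<tau> (Suc k) / of_nat (Suc k)" for k
  define y where "y = norm (1 - z)"
  have norm_h: "norm (h k) = 1 / real (Suc k)" for k by (simp add: h_def norm_divide del: of_nat_Suc)
  have Re_h: "Re (h k) = cos (\<tau> * ln (real (Suc k))) / real (Suc k)" for k
    by (simp add: h_def power_twist_def Re_divide_of_nat del: of_nat_Suc)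
  have head: "Re (\<Sum>k<N. h k * z ^ Suc k) \<le> (\<Sum>k<N. cos (\<tau> * ln (real (Suc k))) / real (Suc k)) + real N * y"
    for N
  proof -
    have "(\<Sum>k<N. h k * z ^ Suc k) - (\<Sum>k<N. h k) = (\<Sum>k<N. h k * (z ^ Suc k - 1 ^ Suc k))"
      by (simp add: algebra_simps sum_subtractf)
    also have "norm \<dots> \<le> (\<Sum>k<N. y)"
    proof (rule sum_norm_le)
      fix k
      have "norm (z ^ Suc k - 1 ^ Suc k) \<le> real (Suc k) * norm (z - 1)"
        using z by (intro norm_power_diff) auto
      then show "norm (h k * (z ^ Suc k - 1 ^ Suc k)) \<le> y"
        unfolding norm_mult norm_h by (simp add: y_def norm_minus_commute field_simps)
    qed
    finally have "Re ((\<Sum>k<N. h k * z ^ Suc k) - (\<Sum>k<N. h k)) \<le> real N * y"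
      using complex_Re_le_cmod order_trans by fastforce
    then show ?thesis by (simp add: Re_h)
  qed
  have g: "cycle_polynomial (power_twist \<tau>) n z = (\<Sum>k<n. h k * z ^ Suc k)"
    by (simp add: cycle_polynomial_def h_def)
  show ?thesis
  proof (cases "real n * y \<le> 1")
    case True
    then show ?thesis using head[of n] by (intro exI[of _ n]) (auto simp: g)
  next
    case False
    then have y: "y > 0" unfolding y_def by (cases "1 - z = 0") auto
    \<comment> \<open>The floor gives N |1 - z| \<le> 1 for the head and 1/(N + 1) < |1 - z| for the
      tail; it may be 0.\<close>
    define N where "N = nat \<lfloor>1 / y\<rfloor>"
    have "real N \<le> 1 / y" "1 / y < real N + 1"
      using y by (simp_all add: N_def of_nat_floor)
    then have Ny: "real N * y \<le> 1" "1 < real (Suc N) * y" using y by (simp_all add: field_simps)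
    have "real N * y < real n * y" using Ny False by linarith
    then have Nn: "N < n" using y by simp
    define m where "m = n - 1"
    have m: "N \<le> m" "n = Suc m" using Nn by (auto simp: m_def)
    have tele: "(\<Sum>k\<in>{N..<m}. 3 * (1 / real (Suc k) - 1 / real (Suc (Suc k)))) = 3 * (1 / real (Suc N) - 1 / real n)"
      using sum_Suc_diff'[OF m(1), of "\<lambda>k. - 1 / real (Suc k)"] m
      by (simp add: sum_distrib_left[symmetric] del: of_nat_Suc right_diff_distrib_numeral)
    have "norm ((1 - z) * (\<Sum>k\<in>{N..m}. h k * z ^ k) + h m * z ^ Suc m)
          \<le> norm (h N) + (\<Sum>k\<in>{N..<m}. norm (h (Suc k) - h k))"
      by (rule abel_summation_bound[OF m(1) z])
    also have "\<dots> \<le> 1 / real (Suc N) + (\<Sum>k\<in>{N..<m}. 3 * (1 / real (Suc k) - 1 / real (Suc (Suc k))))"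
      unfolding norm_h by (intro add_left_mono sum_mono) (simp only: h_def norm_power_twist_quotient_diff_le \<tau>)
    also have "\<dots> = 1 / real (Suc N) + 3 * (1 / real (Suc N) - 1 / real n)" by (simp only: tele)
    finally have "norm ((1 - z) * (\<Sum>k\<in>{N..m}. h k * z ^ k)) \<le> 4 / real (Suc N) - 3 / real n + norm (h m * z ^ Suc m)"
      using norm_triangle_ineq4[of "(1 - z) * (\<Sum>k\<in>{N..m}. h k * z ^ k) + h m * z ^ Suc m" "h m * z ^ Suc m"]
      by simp
    also have "norm (h m * z ^ Suc m) = 1 / real n"
      unfolding norm_mult norm_power z norm_h m by simp
    also have "4 / real (Suc N) - 3 / real n + 1 / real n \<le> 4 / real (Suc N)" by simp
    also have "\<dots> \<le> 4 * y" using Ny by (simp add: field_simps)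
    finally have "norm (\<Sum>k\<in>{N..m}. h k * z ^ k) \<le> 4"
      using y by (simp add: norm_mult y_def)
    moreover have "(\<Sum>k\<in>{N..m}. h k * z ^ Suc k) = z * (\<Sum>k\<in>{N..m}. h k * z ^ k)"
      by (simp add: sum_distrib_left mult_ac)
    ultimately have "norm (\<Sum>k\<in>{N..m}. h k * z ^ Suc k) \<le> 4" using z by (simp add: norm_mult)
    then have "Re (\<Sum>k\<in>{N..m}. h k * z ^ Suc k) \<le> 4" using complex_Re_le_cmod order_trans by blast
    moreover have "(\<Sum>k<n. h k * z ^ Suc k) = (\<Sum>k<N. h k * z ^ Suc k) + (\<Sum>k\<in>{N..m}. h k * z ^ Suc k)"
      unfolding m(2) lessThan_Suc_atMost
      by (subst sum.union_disjoint[symmetric]) (use m in \<open>auto intro!: sum.cong\<close>)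
    ultimately have "Re (\<Sum>k<n. h k * z ^ Suc k) \<le> (\<Sum>k<N. cos (\<tau> * ln (real (Suc k))) / real (Suc k)) + 5"
      using head[of N] Ny(1) by (simp only: plus_complex.sel)
    then show ?thesis unfolding g using Nn by (intro exI[of _ N] conjI) simp_all
  qed
qed

text \<open>Abel summation: the first coefficient and the boundary term contribute 1 each, and the
  total variation of the coefficients is at most \<open>\<bar>\<tau>\<bar> * harm n\<close>.\<close>

lemma norm_cycle_polynomial_deriv_le:
  assumes z: "norm z = 1"
  shows "norm (1 - z) * norm (cycle_polynomial_deriv (power_twist \<tau>) n z) \<le> 2 + \<bar>\<tau>\<bar> * harm n"
proof (cases n)
  case 0
  then show ?thesis by (simp add: cycle_polynomial_deriv_def harm_nonneg)
next
  case (Suc m)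
  define h where "h k = power_twist \<tau> (Suc k)" for k
  have g: "cycle_polynomial_deriv (power_twist \<tau>) n z = (\<Sum>k\<in>{0..m}. h k * z ^ k)"
    by (simp add: cycle_polynomial_deriv_def h_def Suc lessThan_Suc_atMost atLeast0AtMost)
  have "norm ((1 - z) * (\<Sum>k\<in>{0..m}. h k * z ^ k) + h m * z ^ Suc m)
          \<le> norm (h 0) + (\<Sum>k\<in>{0..<m}. norm (h (Suc k) - h k))"
    by (rule abel_summation_bound[OF _ z]) simp
  also have "\<dots> \<le> 1 + (\<Sum>k\<in>{0..<m}. \<bar>\<tau>\<bar> / real (Suc k))"
    unfolding h_def by (intro add_mono sum_mono norm_power_twist_diff_le) simp
  also have "\<dots> = 1 + \<bar>\<tau>\<bar> * harm m"
    by (simp add: harm_conv_sum sum_distrib_left atLeast0LessThan)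
  also have "\<dots> \<le> 1 + \<bar>\<tau>\<bar> * harm n"
    by (intro add_left_mono mult_left_mono harm_mono) (auto simp: Suc)
  finally have "norm ((1 - z) * (\<Sum>k\<in>{0..m}. h k * z ^ k)) \<le> 1 + \<bar>\<tau>\<bar> * harm n + norm (h m * z ^ Suc m)"
    using norm_triangle_ineq4[of "(1 - z) * (\<Sum>k\<in>{0..m}. h k * z ^ k) + h m * z ^ Suc m" "h m * z ^ Suc m"]
    by simp
  also have "norm (h m * z ^ Suc m) = 1"
    unfolding norm_mult norm_power z h_def by simp
  finally show ?thesis by (simp add: g norm_mult)
qed

lemma norm_cycle_polynomial_deriv_le_n:
  assumes z: "norm z = 1"
  shows "norm (cycle_polynomial_deriv (power_twist \<tau>) n z) \<le> real n"
proof -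
  have "norm (cycle_polynomial_deriv (power_twist \<tau>) n z) \<le> (\<Sum>k<n. 1)"
    unfolding cycle_polynomial_deriv_def by (rule sum_norm_le) (simp add: norm_mult norm_power z)
  then show ?thesis by simp
qed

text \<open>Comparing coefficients in F' = g' F reproduces the recurrence of
  \<open>cycle_mean\<close>; truncating g at degree \<open>n\<close> does not affect coefficients of
  index up to \<open>n\<close>.\<close>

lemma fps_expansion_exp_cycle_polynomial_nth:
  assumes "m \<le> n"
  shows "fps_nth (fps_expansion (\<lambda>z. exp (cycle_polynomial f n z)) 0) m = cycle_mean f m"
proof -
  define F where "F = (\<lambda>z. exp (cycle_polynomial f n z))"
  define A where "A = fps_expansion F 0"
  define G where "G = (\<Sum>k<n. fps_const (f (Suc k)) * fps_X ^ k)"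
  have deriv: "(F has_field_derivative F z * cycle_polynomial_deriv f n z) (at z)" for z
    unfolding F_def by (rule DERIV_fun_exp has_field_derivative_cycle_polynomial)+
  have "F holomorphic_on UNIV"
    using deriv by (auto simp: holomorphic_on_open)
  then have F: "F has_fps_expansion A"
    unfolding A_def by (intro has_fps_expansion_fps_expansion) auto
  have "deriv F = (\<lambda>z. cycle_polynomial_deriv f n z * F z)"
    using deriv by (auto simp: DERIV_imp_deriv mult.commute)
  moreover have "cycle_polynomial_deriv f n has_fps_expansion G"
    unfolding cycle_polynomial_deriv_def[abs_def] G_def
    by (intro fps_expansion_intros)
  ultimately have "deriv F has_fps_expansion G * A"
    using F by (auto intro: fps_expansion_intros)
  with has_fps_expansion_deriv[OF F] have eq: "fps_deriv A = G * A"
    using fps_expansion_unique_complex by blast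
  have G: "fps_nth G k = (if k < n then f (Suc k) else 0)" for k
    unfolding G_def by (simp add: fps_sum_nth fps_X_power_nth if_distrib cong: if_cong)
  have "fps_nth A m = cycle_mean f m" using assms
  proof (induction m rule: less_induct)
    case (less m)
    show ?case
    proof (cases m)
      case 0
      have "fps_nth A 0 = F 0" using F has_fps_expansion_imp_0_eq_fps_nth_0 by metis
      then show ?thesis by (simp add: 0 F_def cycle_polynomial_def)
    next
      case (Suc l)
      have "of_nat (Suc l) * fps_nth A (Suc l) = (\<Sum>k\<le>l. fps_nth G k * fps_nth A (l - k))"
        using arg_cong[OF eq, of "\<lambda>a. fps_nth a l"]
        by (simp add: fps_mult_nth atLeast0AtMost)
      also have "\<dots> = (\<Sum>k\<le>l. f (Suc k) * cycle_mean f (l - k))"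
        using less Suc by (intro sum.cong) (auto simp: G)
      finally show ?thesis by (simp add: Suc field_simps del: of_nat_Suc)
    qed
  qed
  then show ?thesis by (simp add: A_def F_def)
qed

text \<open>Cauchy's formula on the unit circle; parametrised over [0, 1], its speed 2\<pi> cancels
  the prefactor of the formula.\<close>

lemma norm_coefficient_le_integral:
  assumes hol: "h holomorphic_on UNIV" and B: "(B has_integral I) {0..1}"
    and le: "\<And>x. 0 \<le> x \<Longrightarrow> x \<le> 1 \<Longrightarrow> norm (h (cis (2 * pi * x))) \<le> B x"
  shows "norm ((deriv ^^ k) h 0 / fact k) \<le> I"
proof -
  have "((\<lambda>u. h u / (u - 0) ^ Suc k) has_contour_integral (2 * pi * \<i>) / fact k * (deriv ^^ k) h 0)
          (circlepath 0 1)"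
    using hol
    by (intro Cauchy_has_contour_integral_higher_derivative_circlepath)
       (auto intro: holomorphic_on_subset holomorphic_on_imp_continuous_on)
  then have I: "((\<lambda>x. h (circlepath 0 1 x) / circlepath 0 1 x ^ Suc k
       * vector_derivative (circlepath 0 1) (at x within {0..1}))
     has_integral (2 * pi * \<i>) / fact k * (deriv ^^ k) h 0) {0..1}" (is "(?F has_integral _) _")
    by (simp add: has_contour_integral_def)
  have "norm (integral {0..1} ?F) \<le> integral {0..1} (\<lambda>x. 2 * pi * B x)"
  proof (rule integral_norm_bound_integral)
    show "?F integrable_on {0..1}" using I by (rule has_integral_integrable)
    show "(\<lambda>x. 2 * pi * B x) integrable_on {0..1}"
      using has_integral_mult_right[OF B] by (rule has_integral_integrable)
    fix x :: real assume x: "x \<in> {0..1}"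
    have "circlepath 0 1 x = cis (2 * pi * x)"
      by (simp add: circlepath cis_conv_exp mult_ac)
    moreover have "norm (vector_derivative (circlepath 0 1) (at x within {0..1})) = 2 * pi"
      using x by (simp add: vector_derivative_circlepath01 norm_mult)
    ultimately show "norm (?F x) \<le> 2 * pi * B x"
      using le[of x] x by (simp add: norm_mult norm_divide norm_power)
  qed
  then have "norm ((2 * pi * \<i>) / fact k * (deriv ^^ k) h 0) \<le> 2 * pi * I"
    using integral_unique[OF I] integral_unique[OF has_integral_mult_right[OF B, of "2 * pi"]] by simp
  then have "2 * pi * norm ((deriv ^^ k) h 0 / fact k) \<le> 2 * pi * I"
    by (simp add: norm_mult norm_divide)
  then show ?thesis by (rule mult_left_le_imp_le) simp
qed

text \<open>On the first half the norm is at least 2 sin(\<pi> x), and sin y \<ge> y/2 for y \<le>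
  8/5 by Taylor. Conjugation maps the second half to the first.\<close>

lemma norm_one_minus_cis_ge:
  assumes "0 \<le> x" "x \<le> 1"
  shows "min x (1 - x) \<le> norm (1 - cis (2 * pi * x))"
proof -
  have half: "x \<le> norm (1 - cis (2 * pi * x))" if "0 \<le> x" "x \<le> 1 / 2" for x
  proof -
    define y where "y = pi * x"
    have "pi * x \<le> 16 / 5 * (1 / 2)" using that pi_approx by (intro mult_mono) auto
    then have y: "0 \<le> y" "y \<le> 8 / 5" using that by (simp_all add: y_def)
    have "\<bar>sin y - (\<Sum>m<3. sin_coeff m * y ^ m)\<bar> \<le> inverse (fact 3) * \<bar>y\<bar> ^ 3"
      by (rule Maclaurin_sin_bound)
    moreover have "(\<Sum>m<3. sin_coeff m * y ^ m) = y"
      by (simp add: sin_coeff_def numeral_eq_Suc)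
    moreover have "inverse (fact 3) * \<bar>y\<bar> ^ 3 \<le> y / 2"
    proof -
      have "y * y\<^sup>2 \<le> y * (8 / 5)\<^sup>2" using y by (intro mult_left_mono power_mono) auto
      also have "\<dots> \<le> y * 3" using y by (intro mult_left_mono) (auto simp: power2_eq_square)
      finally show ?thesis using y by (simp add: fact_numeral power2_eq_square power3_eq_cube)
    qed
    ultimately have "y / 2 \<le> sin y" by linarith
    moreover have "x \<le> y" using that pi_ge_two mult_right_mono[of 1 pi x] by (simp add: y_def)
    ultimately have "x \<le> 2 * sin y" by linarith
    also have "2 * sin y \<le> norm (1 - cis (2 * y))"
    proof -
      have "1 - cis (2 * y) = cis y * (cis (- y) - cis y)"
        by (simp add: algebra_simps cis_mult)
      then have "norm (1 - cis (2 * y)) = norm (cis (- y) - cis y)" by (simp add: norm_mult)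
      also have "\<dots> \<ge> \<bar>Im (cis (- y) - cis y)\<bar>" by (rule abs_Im_le_cmod)
      finally show ?thesis by simp
    qed
    finally show ?thesis by (simp add: y_def mult_ac)
  qed
  show ?thesis
  proof (cases "x \<le> 1 / 2")
    case True
    then show ?thesis using half[of x] assms by simp
  next
    case False
    have "cis (2 * pi * (1 - x)) = cis (2 * pi) * cis (- (2 * pi * x))"
      unfolding cis_mult by (simp add: algebra_simps)
    also have "\<dots> = cnj (cis (2 * pi * x))" by (simp add: cis_cnj)
    finally have "cis (2 * pi * (1 - x)) = cnj (cis (2 * pi * x))" .
    then have "norm (1 - cis (2 * pi * (1 - x))) = norm (cnj (1 - cis (2 * pi * x)))" by simp
    also have "\<dots> = norm (1 - cis (2 * pi * x))" by (rule complex_mod_cnj)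
    finally show ?thesis using half[of "1 - x"] assms False by simp
  qed
qed

section \<open>The two ranges\<close>

lemma sum_inverse_squares_le:
  assumes "1 \<le> n"
  shows "(\<Sum>k<n. 1 / (real (Suc k))\<^sup>2) \<le> 2 - 1 / real n"
  using assms
proof (induction n rule: nat_induct_at_least)
  case (Suc n)
  define a where "a = real n"
  have a: "a \<ge> 1" using Suc by (simp add: a_def)
  have "1 / (a + 1)\<^sup>2 \<le> 1 / (a * (a + 1))"
    using a by (intro divide_left_mono) (auto simp: power2_eq_square)
  also have "\<dots> = 1 / a - 1 / (a + 1)" using a by (simp add: field_simps)
  finally show ?case using Suc by (simp add: a_def add.commute)
qed simp

lemma cos_ln_sum_le_abs:
  assumes "\<tau> \<noteq> 0" "\<bar>\<tau>\<bar> \<le> 2" "1 \<le> N"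
  shows "(\<Sum>k<N. cos (\<tau> * ln (real (Suc k))) / real (Suc k)) \<le> sin (\<bar>\<tau>\<bar> * ln (real N)) / \<bar>\<tau>\<bar> + 4"
proof -
  have "cos (\<tau> * x) = cos (\<bar>\<tau>\<bar> * x)" for x by (cases "\<tau> \<ge> 0") auto
  moreover have "(\<Sum>k<N. cos (\<bar>\<tau>\<bar> * ln (real (Suc k))) / real (Suc k))
      \<le> sin (\<bar>\<tau>\<bar> * ln (real N)) / \<bar>\<tau>\<bar> + 4 - 3 / real N"
    using assms by (intro cos_ln_sum_le) auto
  then have "(\<Sum>k<N. cos (\<bar>\<tau>\<bar> * ln (real (Suc k))) / real (Suc k))
      \<le> sin (\<bar>\<tau>\<bar> * ln (real N)) / \<bar>\<tau>\<bar> + 4"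
    using divide_nonneg_nonneg[of 3 "real N"] by linarith
  ultimately show ?thesis by (simp only:)
qed

lemma ln_ge_half:
  assumes "2 \<le> n"
  shows "1 / 2 \<le> ln (real n)"
proof -
  have "ln (1 / real n) \<le> 1 / real n - 1" using assms by (intro ln_le_minus_one) auto
  moreover have "ln (1 / real n) = - ln (real n)" using assms by (simp add: ln_div)
  moreover have "1 / real n \<le> 1 / 2" using assms by (simp add: divide_le_eq)
  ultimately show ?thesis by linarith
qed

lemma norm_cycle_mean_power_twist_small:
  assumes n: "2 \<le> n" and \<tau>: "\<bar>\<tau>\<bar> * ln (real n) \<le> 1 / 24"
  shows "norm (cycle_mean (power_twist \<tau>) n) \<le> exp 7 * exp (- (2 / 15 * \<tau>\<^sup>2 * ln (real n) ^ 3))"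
proof -
  define L where "L = ln (real n)"
  have L: "L \<ge> 1 / 2" unfolding L_def by (rule ln_ge_half[OF n])
  have "L \<le> ln (real n + 1)" unfolding L_def using n by (subst ln_le_cancel_iff) auto
  then have harm: "harm n \<le> 3 * L" "harm n \<ge> L"
    using harm_le_ln_plus_1[of n] ln_le_harm[of n] L n unfolding L_def by linarith+
  have "\<bar>\<tau>\<bar> * harm n \<le> \<bar>\<tau>\<bar> * (3 * L)" using harm by (intro mult_left_mono) auto
  \<comment> \<open>Here \<open>harm n\<close> is at most three times the logarithm, and 2 * 3 / 24
    = 1/4; this is the origin of 1/24.\<close>
  then have \<tau>h: "2 * \<bar>\<tau>\<bar> * harm n \<le> 1 / 4" using \<tau> by (simp add: L_def)
  have "\<bar>\<tau>\<bar> * (1 / 2) \<le> \<bar>\<tau>\<bar> * L" using L by (intro mult_left_mono) auto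
  then have \<tau>2: "\<bar>\<tau>\<bar> \<le> 2" using \<tau> by (simp add: L_def)
  define c where "c = (\<Sum>k<n. cos (\<tau> * ln (real (Suc k))) / real (Suc k))"
  have c: "c - harm n \<le> 4 - 2 / 15 * \<tau>\<^sup>2 * L ^ 3"
  proof (cases "\<tau> = 0")
    case True
    then show ?thesis by (simp add: c_def harm_conv_sum)
  next
    case False
    have "c \<le> sin (\<bar>\<tau>\<bar> * L) / \<bar>\<tau>\<bar> + 4"
      unfolding c_def L_def using False \<tau>2 n by (intro cos_ln_sum_le_abs) auto
    also have "\<dots> \<le> (\<bar>\<tau>\<bar> * L) * (1 - 2 / 15 * (\<bar>\<tau>\<bar> * L)\<^sup>2) / \<bar>\<tau>\<bar> + 4"
      using \<tau> L by (intro add_right_mono divide_right_mono sin_le_cubic) (auto simp: L_def)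
    also have "\<dots> = L - 2 / 15 * \<tau>\<^sup>2 * L ^ 3 + 4"
      using False by (simp add: field_simps power2_eq_square power3_eq_cube)
    finally show ?thesis using harm by linarith
  qed
  have "norm (cycle_mean (power_twist \<tau>) n)
    \<le> exp (\<Sum>k<n. (cos (\<tau> * ln (real (Suc k))) - 1) / real (Suc k)
              + 2 * \<bar>\<tau>\<bar> / real (Suc k) + 1 / (real (Suc k))\<^sup>2)"
    by (rule cycle_mean_power_twist_le_exp[OF \<tau>h order_refl])
  also have "(\<Sum>k<n. (cos (\<tau> * ln (real (Suc k))) - 1) / real (Suc k)
              + 2 * \<bar>\<tau>\<bar> / real (Suc k) + 1 / (real (Suc k))\<^sup>2)
      = c - harm n + 2 * \<bar>\<tau>\<bar> * harm n + (\<Sum>k<n. 1 / (real (Suc k))\<^sup>2)"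
    by (simp add: sum.distrib sum_subtractf diff_divide_distrib c_def harm_conv_sum sum_distrib_left
        del: of_nat_Suc)
  \<comment> \<open>The three contributions are at most 4, 1/4 and 2, apart from the main
    term.\<close>
  also have "\<dots> \<le> 7 + - (2 / 15 * \<tau>\<^sup>2 * L ^ 3)"
  proof -
    have "0 \<le> 1 / real n" by simp
    then show ?thesis using c \<tau>h sum_inverse_squares_le[of n] n by linarith
  qed
  finally show ?thesis by (simp add: L_def exp_add[symmetric])
qed

text \<open>If the cut N has ln N \<le> L/2, the trivial harmonic bound already saves half of the
  logarithm. Otherwise |\<tau>| ln N \<ge> c/2, and the sine saves the proportion (2/15)(c/2)^2 =
  c^2/30. The 9 collects 5 from the cut and 4 from the cosine sum.\<close>

lemma Re_cycle_polynomial_power_twist_le: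
  assumes c: "0 < c" "c \<le> 1" and n: "2 \<le> n" and \<tau>: "c \<le> \<bar>\<tau>\<bar> * ln (real n)" "\<bar>\<tau>\<bar> \<le> 2"
    and z: "norm z = 1"
  shows "Re (cycle_polynomial (power_twist \<tau>) n z) \<le> (1 - c\<^sup>2 / 30) * ln (real n) + 9"
proof -
  define L where "L = ln (real n)"
  have L: "L \<ge> 1 / 2" unfolding L_def by (rule ln_ge_half[OF n])
  have \<tau>0: "\<tau> \<noteq> 0" using \<tau> c by auto
  have c2: "c\<^sup>2 \<le> 1" using c by (simp add: power_le_one)
  define H where "H N = (\<Sum>k<N. cos (\<tau> * ln (real (Suc k))) / real (Suc k))" for N
  obtain N where N: "N \<le> n" "Re (cycle_polynomial (power_twist \<tau>) n z) \<le> H N + 5"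
    unfolding H_def using Re_cycle_polynomial_le[OF \<tau>(2) z] by blast
  have half: "L / 2 \<le> (1 - c\<^sup>2 / 30) * L"
    using mult_right_mono[of "1 / 2" "1 - c\<^sup>2 / 30" L] c2 L by simp
  have "H N \<le> (1 - c\<^sup>2 / 30) * L + 4"
  proof (cases "N = 0")
    case True
    then show ?thesis using half L by (simp add: H_def)
  next
    case False
    then have N1: "1 \<le> N" by simp
    then have lnN: "0 \<le> ln (real N)" "ln (real N) \<le> L" using N by (auto simp: L_def)
    show ?thesis
    proof (cases "ln (real N) \<le> L / 2")
      case True
      have "H N \<le> harm N"
        unfolding H_def harm_conv_sum by (intro sum_mono divide_right_mono) auto
      then show ?thesis using harm_le_ln_plus_1[OF N1] True half by linarith
    next
      case False
      have "c / 2 \<le> \<bar>\<tau>\<bar> * (L / 2)" using \<tau> by (simp add: L_def)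
      also have "\<dots> \<le> \<bar>\<tau>\<bar> * ln (real N)" using False by (intro mult_left_mono) auto
      finally have cN: "c / 2 \<le> \<bar>\<tau>\<bar> * ln (real N)" .
      have "H N \<le> sin (\<bar>\<tau>\<bar> * ln (real N)) / \<bar>\<tau>\<bar> + 4"
        unfolding H_def by (rule cos_ln_sum_le_abs[OF \<tau>0 \<tau>(2) N1])
      also have "\<dots> \<le> (\<bar>\<tau>\<bar> * ln (real N)) * (1 - 2 / 15 * (c / 2)\<^sup>2) / \<bar>\<tau>\<bar> + 4"
        using c cN by (intro add_right_mono divide_right_mono sin_le_mult_of_ge) auto
      also have "\<dots> = (1 - c\<^sup>2 / 30) * ln (real N) + 4"
        using \<tau>0 by (simp add: power_divide)
      also have "\<dots> \<le> (1 - c\<^sup>2 / 30) * L + 4"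
        using lnN c2 by (intro add_right_mono mult_left_mono) auto
      finally show ?thesis .
    qed
  qed
  then show ?thesis using N unfolding L_def by linarith
qed

lemma has_integral_inverse_shift:
  assumes "(e :: real) > 0"
  shows "((\<lambda>x. 1 / (e + x) + 1 / (e + (1 - x))) has_integral 2 * ln ((e + 1) / e)) {0..1}"
proof -
  have "((\<lambda>x. 1 / (e + x) + 1 / (e + (1 - x))) has_integral
      (ln (e + 1) - ln (e + (1 - 1))) - (ln (e + 0) - ln (e + (1 - 0)))) {0..1}"
    by (rule fundamental_theorem_of_calculus)
       (use assms in \<open>auto intro!: derivative_eq_intros simp flip: has_real_derivative_iff_has_vector_derivative\<close>)
  then show ?thesis using assms by (simp add: ln_div)
qed

text \<open>Cauchy's formula for the coefficient of z^(n-1) in F' = g' F. The two bounds on g'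
  together give a majorant of order 1/(1/n + distance to 1), whose integral is only logarithmic in
  n.\<close>

lemma norm_cycle_mean_le_integral:
  assumes n: "1 \<le> n" and D: "0 \<le> D" and R: "\<And>z. norm z = 1 \<Longrightarrow> Re (cycle_polynomial f n z) \<le> R"
    and D1: "\<And>z. norm z = 1 \<Longrightarrow> norm (cycle_polynomial_deriv f n z) \<le> real n"
    and D2: "\<And>z. norm z = 1 \<Longrightarrow> norm (1 - z) * norm (cycle_polynomial_deriv f n z) \<le> D"
  shows "real n * norm (cycle_mean f n) \<le> (1 + D) * exp R * (2 * ln (real n + 1))"
proof -
  define F where "F = (\<lambda>z. exp (cycle_polynomial f n z))"
  define h where "h = (\<lambda>z. F z * cycle_polynomial_deriv f n z)"
  have deriv: "(F has_field_derivative h z) (at z)" for z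
    unfolding F_def h_def by (rule DERIV_fun_exp has_field_derivative_cycle_polynomial)+
  then have dF: "deriv F = h" by (auto simp: DERIV_imp_deriv)
  have "F holomorphic_on UNIV" using deriv by (auto simp: holomorphic_on_open)
  then have hol: "h holomorphic_on UNIV" unfolding dF[symmetric] by (rule holomorphic_deriv) simp
  obtain m where m: "n = Suc m" using n by (cases n) auto
  have "(deriv ^^ m) h 0 = (deriv ^^ n) F 0"
    unfolding m funpow_Suc_right dF[symmetric] by simp
  also have "\<dots> = fact n * cycle_mean f n"
    using fps_expansion_exp_cycle_polynomial_nth[of n n f]
    by (simp add: fps_expansion_def F_def field_simps)
  finally have coeff: "(deriv ^^ m) h 0 / fact m = of_nat n * cycle_mean f n"
    by (simp add: m field_simps del: cycle_mean.simps)
  \<comment> \<open>The scale at which the bound \<open>real n\<close> near z = 1 takes over from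
    the bound D/|1 - z|.\<close>
  define e where "e = 1 / real n"
  have e: "e > 0" using n by (simp add: e_def)
  have "norm ((deriv ^^ m) h 0 / fact m) \<le> (1 + D) * exp R * (2 * ln ((e + 1) / e))"
  proof (rule norm_coefficient_le_integral[OF hol has_integral_mult_right[OF has_integral_inverse_shift[OF e]]])
    fix x :: real assume x: "0 \<le> x" "x \<le> 1"
    define z where "z = cis (2 * pi * x)"
    have z: "norm z = 1" by (simp add: z_def)
    define g where "g = norm (cycle_polynomial_deriv f n z)"
    have "min x (1 - x) * g \<le> norm (1 - z) * g"
      unfolding z_def g_def using norm_one_minus_cis_ge[OF x] by (intro mult_right_mono) auto
    then have "min x (1 - x) * g \<le> D" using D2[OF z] by (simp add: g_def)
    moreover have "e * g \<le> 1" using D1[OF z] n by (simp add: g_def e_def field_simps)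
    ultimately have "(e + min x (1 - x)) * g \<le> 1 + D" by (simp add: distrib_right)
    then have "g \<le> (1 + D) * (1 / (e + min x (1 - x)))"
      using e x by (simp add: field_simps min_def split: if_splits)
    \<comment> \<open>Adding the fractions for both endpoints removes the minimum and leaves an
      elementary integrand.\<close>
    also have "\<dots> \<le> (1 + D) * (1 / (e + x) + 1 / (e + (1 - x)))"
      using e x D by (intro mult_left_mono) (auto simp: min_def)
    finally have g: "g \<le> (1 + D) * (1 / (e + x) + 1 / (e + (1 - x)))" .
    have "norm (F z) \<le> exp R" using R[OF z] by (simp add: F_def)
    then have "norm (h z) \<le> exp R * ((1 + D) * (1 / (e + x) + 1 / (e + (1 - x))))"
      unfolding h_def norm_mult using g by (intro mult_mono) (auto simp: g_def)
    then show "norm (h (cis (2 * pi * x))) \<le> (1 + D) * exp R * (1 / (e + x) + 1 / (e + (1 - x)))"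
      by (simp only: z_def mult_ac)
  qed
  also have "(e + 1) / e = real n + 1" using n by (simp add: e_def field_simps)
  finally show ?thesis unfolding coeff by (simp add: norm_mult)
qed

text \<open>The bound on the real part saves n^(-c^2/30); half of this exponent is given up to
  absorb the two logarithmic factors, one from g' and one from the integral.\<close>

lemma norm_cycle_mean_power_twist_large:
  assumes c: "0 < c" "c \<le> 1"
  shows "\<exists>C. \<forall>n \<tau>. 2 \<le> n \<longrightarrow> c \<le> \<bar>\<tau>\<bar> * ln (real n) \<longrightarrow> \<bar>\<tau>\<bar> \<le> 2 \<longrightarrow>
           norm (cycle_mean (power_twist \<tau>) n) \<le> C * (1 / real n powr (c\<^sup>2 / 60))"
proof -
  \<comment> \<open>Each logarithm is bounded by a multiple of n^a; the square of n^a is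
    n^(c^2/60).\<close>
  define a where "a = c\<^sup>2 / 120"
  have a: "a > 0" using c by (simp add: a_def)
  define K where "K = 5 + 2 / a"
  have K: "K > 0" using a by (simp add: K_def add_pos_pos)
  have "norm (cycle_mean (power_twist \<tau>) n) \<le> 2 * exp 9 * K\<^sup>2 * (1 / real n powr (c\<^sup>2 / 60))"
    if n: "2 \<le> n" and \<tau>: "c \<le> \<bar>\<tau>\<bar> * ln (real n)" "\<bar>\<tau>\<bar> \<le> 2" for n \<tau>
  proof -
    define L where "L = ln (real n)"
    have L: "L \<ge> 1 / 2" unfolding L_def by (rule ln_ge_half[OF n])
    have D: "2 + \<bar>\<tau>\<bar> * harm n \<le> 4 + 2 * L"
      using mult_mono[OF \<tau>(2) harm_le_ln_plus_1[of n]] n by (simp add: harm_nonneg L_def)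
    have n1: "ln (real n + 1) \<le> L + 1"
    proof -
      have "ln (real n + 1) \<le> ln (real n * exp 1)"
      proof -
        have "real n * 2 \<le> real n * exp 1"
          using exp_ge_add_one_self[of 1] by (intro mult_left_mono) auto
        then have "real n + 1 \<le> real n * exp 1" using n by linarith
        then show ?thesis using n by (subst ln_le_cancel_iff) auto
      qed
      also have "\<dots> = L + 1" using n by (simp add: ln_mult L_def)
      finally show ?thesis .
    qed
    have "real n * norm (cycle_mean (power_twist \<tau>) n)
        \<le> (1 + (4 + 2 * L)) * exp ((1 - c\<^sup>2 / 30) * ln (real n) + 9) * (2 * ln (real n + 1))"
    proof (rule norm_cycle_mean_le_integral)
      show "norm (1 - z) * norm (cycle_polynomial_deriv (power_twist \<tau>) n z) \<le> 4 + 2 * L"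
        if "norm z = 1" for z
        by (rule order_trans[OF norm_cycle_polynomial_deriv_le[OF that] D])
    qed (use c n \<tau> L in \<open>auto intro: Re_cycle_polynomial_power_twist_le norm_cycle_polynomial_deriv_le_n\<close>)
    \<comment> \<open>Enlarging the factor from the integral makes both logarithmic factors equal,
      so they combine to a square.\<close>
    also have "\<dots> \<le> (5 + 2 * L) * exp ((1 - c\<^sup>2 / 30) * ln (real n) + 9) * (2 * (5 + 2 * L))"
      using n1 L n by (intro mult_mono mult_nonneg_nonneg ln_ge_zero) auto
    also have "\<dots> = real n * (2 * exp 9 * (5 + 2 * L)\<^sup>2 * (1 / real n powr (c\<^sup>2 / 30)))"
    proof -
      have "exp ((1 - c\<^sup>2 / 30) * ln (real n) + 9) = exp (ln (real n)) * exp 9 / exp (c\<^sup>2 / 30 * ln (real n))"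
        by (simp add: exp_add[symmetric] exp_diff[symmetric] algebra_simps)
      then show ?thesis using n by (simp add: powr_def power2_eq_square)
    qed
    also have "\<dots> \<le> real n * (2 * exp 9 * (K * real n powr a)\<^sup>2 * (1 / real n powr (c\<^sup>2 / 30)))"
    proof (intro mult_left_mono mult_right_mono power_mono)
      have "L \<le> real n powr a / a" unfolding L_def using a n by (intro ln_powr_bound) auto
      moreover have "1 \<le> real n powr a" using n a by (intro ge_one_powr_ge_zero) auto
      ultimately show "5 + 2 * L \<le> K * real n powr a"
        by (simp add: K_def distrib_right)
    qed (use L in auto)
    also have "\<dots> = real n * (2 * exp 9 * K\<^sup>2 * (1 / real n powr (c\<^sup>2 / 60)))"
    proof -
      have "(real n powr a)\<^sup>2 = real n powr (c\<^sup>2 / 60)"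
        by (simp add: power2_eq_square a_def flip: powr_add)
      moreover have "real n powr (c\<^sup>2 / 30) = real n powr (c\<^sup>2 / 60) * real n powr (c\<^sup>2 / 60)"
        by (simp flip: powr_add)
      ultimately show ?thesis using n by (simp add: power_mult_distrib)
    qed
    finally show ?thesis by (rule mult_left_le_imp_le) (use n in simp)
  qed
  then show ?thesis by blast
qed

theorem theorem15:
  shows "\<exists>u \<delta>\<^sub>1 :: real. u > 0 \<and> \<delta>\<^sub>1 > 0 \<and>
    (\<exists>C :: real. \<forall>n :: nat. \<forall>t :: real. n \<ge> 2 \<and> \<bar>t\<bar> \<le> \<delta>\<^sub>1 * ln (real n) powr (1 / 2) \<longrightarrow>
       cmod (log_product_char n t) \<le> C * exp (- (t\<^sup>2 / 4))) \<and>
    (\<exists>C :: real. \<forall>n :: nat. \<forall>t :: real. n \<ge> 2 \<and> \<delta>\<^sub>1 * ln (real n) powr (1 / 2) < \<bar>t\<bar> \<and>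
         \<bar>t\<bar> \<le> ln (real n) powr (3 / 2) \<longrightarrow>
       cmod (log_product_char n t) \<le> C * (1 / real n powr u))"
proof -
  define \<tau> where "\<tau> n t = t * sqrt 3 / ln (real n) powr (3 / 2)" for n :: nat and t :: real
  have \<phi>: "norm (log_product_char n t) = norm (cycle_mean (power_twist (\<tau> n t)) n)" for n t
    unfolding \<tau>_def by (rule norm_log_product_char)
  have \<tau>L: "\<bar>\<tau> n t\<bar> * ln (real n) = \<bar>t\<bar> * sqrt 3 / ln (real n) powr (1 / 2)"
    and \<tau>3: "(\<tau> n t)\<^sup>2 * ln (real n) ^ 3 = 3 * t\<^sup>2"
    and Lpos: "ln (real n) powr (1 / 2) > 0" "ln (real n) powr (3 / 2) > 0"
    if "2 \<le> n" for n t
  proof -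
    define L where "L = ln (real n)"
    have L: "L > 0" using ln_ge_half[OF that] by (simp add: L_def)
    have "L powr (3 / 2) = L powr (1 / 2) * L" using powr_add[of L "1 / 2" 1] L by simp
    then show "\<bar>\<tau> n t\<bar> * ln (real n) = \<bar>t\<bar> * sqrt 3 / ln (real n) powr (1 / 2)"
      unfolding \<tau>_def L_def[symmetric] using L by (simp add: abs_mult)
    have "(L powr (3 / 2))\<^sup>2 = L ^ 3"
      using L powr_realpow[of L 3] by (simp add: power2_eq_square flip: powr_add)
    then show "(\<tau> n t)\<^sup>2 * ln (real n) ^ 3 = 3 * t\<^sup>2"
      unfolding \<tau>_def L_def[symmetric] using L by (simp add: power_divide power_mult_distrib)
    show "ln (real n) powr (1 / 2) > 0" "ln (real n) powr (3 / 2) > 0"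
      using L by (simp_all add: L_def)
  qed
  have sqrt3: "1 \<le> sqrt 3" "sqrt 3 \<le> (2 :: real)"
    by (auto intro: real_le_rsqrt real_le_lsqrt)
  \<comment> \<open>The constant 1/48 becomes \<open>\<delta>\<^sub>1\<close>: as 1 \<le> sqrt 3
    \<le> 2, values of t below the threshold give |\<tau>| ln n \<le> 1/24, as the small range
    requires, and values above it give at least 1/48, the \<open>c\<close> of the large
    range.\<close>
  obtain C where C: "\<And>n \<tau>. 2 \<le> n \<Longrightarrow> 1 / 48 \<le> \<bar>\<tau>\<bar> * ln (real n) \<Longrightarrow> \<bar>\<tau>\<bar> \<le> 2 \<Longrightarrow>
           norm (cycle_mean (power_twist \<tau>) n) \<le> C * (1 / real n powr ((1 / 48)\<^sup>2 / 60))"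
    using norm_cycle_mean_power_twist_large[of "1 / 48"] by auto
  have small: "norm (log_product_char n t) \<le> exp 7 * exp (- (t\<^sup>2 / 4))"
    if n: "2 \<le> n" and t: "\<bar>t\<bar> \<le> 1 / 48 * ln (real n) powr (1 / 2)" for n t
  proof -
    have "\<bar>\<tau> n t\<bar> * ln (real n) = \<bar>t\<bar> / ln (real n) powr (1 / 2) * sqrt 3"
      using \<tau>L[OF n, of t] by simp
    also have "\<dots> \<le> 1 / 48 * 2"
      using t Lpos(1)[OF n] sqrt3 by (intro mult_mono) (auto simp: field_simps)
    finally have "norm (log_product_char n t) \<le> exp 7 * exp (- (2 / 15 * (\<tau> n t)\<^sup>2 * ln (real n) ^ 3))"
      unfolding \<phi> using n by (intro norm_cycle_mean_power_twist_small) auto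
    \<comment> \<open>The factor 3 from the variance normalisation turns 2/15 into 2/5, which
      exceeds the required 1/4.\<close>
    also have "2 / 15 * (\<tau> n t)\<^sup>2 * ln (real n) ^ 3 = 2 / 5 * t\<^sup>2"
      using \<tau>3[OF n, of t] by simp
    also have "exp 7 * exp (- (2 / 5 * t\<^sup>2)) \<le> exp 7 * exp (- (t\<^sup>2 / 4))"
      by (intro mult_left_mono) auto
    finally show ?thesis .
  qed
  have large: "norm (log_product_char n t) \<le> C * (1 / real n powr ((1 / 48)\<^sup>2 / 60))"
    if n: "2 \<le> n" and t: "1 / 48 * ln (real n) powr (1 / 2) < \<bar>t\<bar>" "\<bar>t\<bar> \<le> ln (real n) powr (3 / 2)" for n t
  proof -
    have "1 / 48 * 1 \<le> \<bar>t\<bar> / ln (real n) powr (1 / 2) * sqrt 3"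
      using t Lpos(1)[OF n] sqrt3 by (intro mult_mono) (auto simp: field_simps)
    then have "1 / 48 \<le> \<bar>\<tau> n t\<bar> * ln (real n)" using \<tau>L[OF n, of t] by simp
    \<comment> \<open>The upper limit on t is used here: it gives |\<tau>| \<le> sqrt 3.\<close>
    moreover have "\<bar>\<tau> n t\<bar> \<le> 2"
    proof -
      have "\<bar>\<tau> n t\<bar> = \<bar>t\<bar> / ln (real n) powr (3 / 2) * sqrt 3"
        using Lpos(2)[OF n] by (simp add: \<tau>_def abs_mult)
      also have "\<dots> \<le> 1 * 2"
        using t Lpos(2)[OF n] sqrt3 by (intro mult_mono) (auto simp: field_simps)
      finally show ?thesis by simp
    qed
    ultimately show ?thesis unfolding \<phi> using n by (intro C)
  qed
  show ?thesis
  proof (intro exI conjI)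
    show "(1 / 48)\<^sup>2 / 60 > (0 :: real)" "1 / 48 > (0 :: real)" by simp_all
  qed (use small large in blast)+
qed

end
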